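(* Let $X(t)$ be a self-dual Hunt process on a state space $D$ with a finite reference measure $m$, and consider the Fleming--Viot system of two particles evolving according to $X(t)$. Then extinction never happens for almost every initial configuration, in both of the following senses: (a) for $m\times m$-almost every $(x,y)\in D\times D$, $\bar{\mathbb P}^{x,y}(\tau_\infty=\infty)=1$; (b) for almost every initial configuration on the diagonal of $D\times D$ (with respect to the measure on the diagonal with marginals $m$), that is, for $m$-almost every $x\in D$, $\bar{\mathbb P}^{x,x}(\tau_\infty=\infty)=1$.
   Context: Hunt process: $X(t)$ is a Hunt process with state space $D$, cemetery point $\partial$ and lifetime $\zeta\in(0,\infty]$ (possibly finite), with law $\mathbb P^x$ when $X(0)=x$; $X(t)=\partial$ for $t\ge\zeta$. Its transition operators are $P_tf(x)=\mathbb E^x f(X(t))$, with the convention $f(\partial)=0$ for functions $f$ on $D$. Self-dual with reference measure $m$: $m$ is a measure on $D$ such that the operators $P_t$ are self-adjoint on $L^2(D,m)$. Fleming--Viot system of two particles $(\bar X(t),\bar Y(t))$ started at $(x,y)\in D\times D$ (law $\bar{\mathbb P}^{x,y}$): set $\tau_0=0$. Let $X_1,Y_1$ be independent copies of $X$ started at $x$ and $y$, with lifetimes $\zeta^{X_1},\zeta^{Y_1}$. Recursively, for $n\ge 1$, let $\sigma_n=\min\{\zeta^{X_n},\zeta^{Y_n}\}$, $\tau_n=\tau_{n-1}+\sigma_n$, and $\bar X(\tau_{n-1}+t)=X_n(t)$, $\bar Y(\tau_{n-1}+t)=Y_n(t)$ for $t\in[0,\sigma_n)$. If $\sigma_n<\infty$,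 let $Z_n=X_n(\zeta^{Y_n})$ when $\zeta^{Y_n}<\zeta^{X_n}$ and $Z_n=Y_n(\zeta^{X_n})$ when $\zeta^{X_n}<\zeta^{Y_n}$ (the position of the surviving particle); given the past, $X_{n+1},Y_{n+1}$ are then independent copies of $X$ both started at $Z_n$. If $\sigma_n=\infty$ the construction ends and $\tau_k=\infty$ for all $k\ge n$. If $\zeta^{X_n}=\zeta^{Y_n}<\infty$, then $Z_n=\partial$, the construction stops, and $\tau_k=\tau_n$ for $k\ge n$. The $\tau_n$, $n\ge1$, are the branching times and $\tau_\infty=\lim_{n\to\infty}\tau_n\in(0,\infty]$. Extinction occurs (at time $\tau_\infty$) if $\tau_\infty<\infty$. *)

theory Defs
  imports "HOL-Probability.Probability"
begin

section \<open>Hunt processes\<close>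

text \<open>
  The type \<open>'s\<close> is the extended state space \<open>D \<union> {\<Delta>}\<close>, with its topology; the cemetery point is
  \<open>\<Delta>\<close> and the state space is \<open>D = - {\<Delta>}\<close>. The sort of \<open>'s\<close> says that this space is separable and
  metrizable (no particular metric is ever used). This covers a locally compact separable metrizable
  \<open>D\<close> with \<open>\<Delta>\<close> the point at infinity, or an isolated point when \<open>D\<close> is compact, and it covers
  metrizable Lusin spaces. Time runs through \<open>[0, \<infinity>]\<close>, i.e. the type \<^typ>\<open>ennreal\<close>, with the
  convention \<open>X \<infinity> = \<Delta>\<close>. A process is a family \<open>X\<close> of maps on a measurable space \<open>\<Omega>\<close> (only the
  \<open>\<sigma>\<close>-algebra of the measure \<open>\<Omega>\<close> matters), together with the laws \<open>P x\<close>.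
\<close>

definition lifetime :: "(ennreal \<Rightarrow> 'w \<Rightarrow> 's) \<Rightarrow> 's \<Rightarrow> 'w \<Rightarrow> ennreal" where
  "lifetime X \<Delta> \<omega> = Inf {t. X t \<omega> = \<Delta>}"

definition natural_filtration ::
    "'w measure \<Rightarrow> (ennreal \<Rightarrow> 'w \<Rightarrow> 's::topological_space) \<Rightarrow> ennreal \<Rightarrow> 'w measure" where
  "natural_filtration \<Omega> X t =
     sigma (space \<Omega>) {X s -` B \<inter> space \<Omega> | s B. s \<le> t \<and> B \<in> sets borel}"

text \<open>The right-continuous version; at \<open>t = \<infinity>\<close> it is the \<open>\<sigma>\<close>-algebra generated by all of \<open>X\<close>.\<close>

definition right_filtration ::
    "'w measure \<Rightarrow> (ennreal \<Rightarrow> 'w \<Rightarrow> 's::topological_space) \<Rightarrow> ennreal \<Rightarrow> 'w measure" where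
  "right_filtration \<Omega> X t =
     sigma (space \<Omega>) (\<Inter>\<epsilon>\<in>{0<..}. sets (natural_filtration \<Omega> X (t + \<epsilon>)))"

lemma filtration_right_filtration: "filtration (space \<Omega>) (right_filtration \<Omega> X)"
proof
  have sp: "space (natural_filtration \<Omega> X t) = space \<Omega>" for t
    unfolding natural_filtration_def by (intro space_measure_of) auto
  have mono: "sets (natural_filtration \<Omega> X s) \<subseteq> sets (natural_filtration \<Omega> X t)" if "s \<le> t" for s t
  proof -
    have *: "{X s -` B \<inter> space \<Omega> | s B. s \<le> t \<and> B \<in> sets borel} \<subseteq> Pow (space \<Omega>)" for t by auto
    show ?thesis unfolding natural_filtration_def sets_measure_of[OF *]
      using that by (intro sigma_sets_mono') (blast intro: order_trans)
  qed
  have sub: "(\<Inter>\<epsilon>\<in>{0<..}. sets (natural_filtration \<Omega> X (t + \<epsilon>))) \<subseteq> Pow (space \<Omega>)" for t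
  proof -
    have "(1::ennreal) \<in> {0<..}" by simp
    then show ?thesis
      using sets.space_closed[of "natural_filtration \<Omega> X (t + 1)"] unfolding sp by blast
  qed
  show "space (right_filtration \<Omega> X t) = space \<Omega>" for t
    unfolding right_filtration_def using sub by (intro space_measure_of) auto
  show "sets (right_filtration \<Omega> X i) \<le> sets (right_filtration \<Omega> X j)" if "i \<le> j" for i j
  proof -
    have "(\<Inter>\<epsilon>\<in>{0<..}. sets (natural_filtration \<Omega> X (i + \<epsilon>)))
      \<subseteq> (\<Inter>\<epsilon>\<in>{0<..}. sets (natural_filtration \<Omega> X (j + \<epsilon>)))"
      using mono[OF add_right_mono[OF that]] by blast
    then show ?thesis unfolding right_filtration_def sets_measure_of[OF sub] by (rule sigma_sets_mono')
  qed
qed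

text \<open>
  The strong Markov property and quasi-left-continuity are required for stopping times of the
  smallest right-continuous filtration to which \<open>X\<close> is adapted, so they hold whenever they hold for
  some larger right-continuous filtration, as in the usual definition. Since
  \<open>X \<infinity> = \<Delta>\<close> and \<open>\<Delta>\<close> is absorbing, the event that the stopping time is infinite need not be
  excluded in the strong Markov property. The cases of a general initial distribution follow by
  integration from those of the laws \<open>P x\<close>.
\<close>

locale hunt_process =
  fixes \<Omega> :: "'w measure"
    and P :: "'s::{metric_space, second_countable_topology} \<Rightarrow> 'w measure"
    and X :: "ennreal \<Rightarrow> 'w \<Rightarrow> 's"
    and \<Delta> :: 's
  assumes kernel: "P \<in> borel \<rightarrow>\<^sub>M prob_algebra \<Omega>"
    and measurable_X: "X t \<in> \<Omega> \<rightarrow>\<^sub>M borel"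
    and normal: "AE \<omega> in P x. X 0 \<omega> = x"
    and infinity: "\<omega> \<in> space \<Omega> \<Longrightarrow> X \<infinity> \<omega> = \<Delta>"
    and absorbing: "\<omega> \<in> space \<Omega> \<Longrightarrow> lifetime X \<Delta> \<omega> \<le> t \<Longrightarrow> X t \<omega> = \<Delta>"
    and right_continuous:
      "\<omega> \<in> space \<Omega> \<Longrightarrow> t < \<infinity> \<Longrightarrow> ((\<lambda>s. X s \<omega>) \<longlongrightarrow> X t \<omega>) (at_right t)"
    and left_limits:
      "\<omega> \<in> space \<Omega> \<Longrightarrow> 0 < t \<Longrightarrow> t < \<infinity> \<Longrightarrow> \<exists>l. ((\<lambda>s. X s \<omega>) \<longlongrightarrow> l) (at_left t)"
    and strong_Markov:
      "stopping_time (right_filtration \<Omega> X) T \<Longrightarrow>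
       \<Lambda> \<in> sets (filtration.pre_sigma (space \<Omega>) (right_filtration \<Omega> X) T) \<Longrightarrow>
       B \<in> sets borel \<Longrightarrow>
       emeasure (P x) {\<omega> \<in> \<Lambda>. X (T \<omega> + s) \<omega> \<in> B} =
         (\<integral>\<^sup>+ \<omega> \<in> \<Lambda>. emeasure (P (X (T \<omega>) \<omega>)) {\<omega>' \<in> space \<Omega>. X s \<omega>' \<in> B} \<partial>P x)"
    and quasi_left_continuous:
      "(\<And>n::nat. stopping_time (right_filtration \<Omega> X) (S n)) \<Longrightarrow>
       (\<And>\<omega>. \<omega> \<in> space \<Omega> \<Longrightarrow> incseq (\<lambda>n. S n \<omega>)) \<Longrightarrow>
       AE \<omega> in P x. (SUP n. S n \<omega>) < \<infinity> \<longrightarrow>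
         (\<lambda>n. X (S n \<omega>) \<omega>) \<longlonglongrightarrow> X (SUP n. S n \<omega>) \<omega>"

section \<open>Self-duality\<close>

text \<open>The integral over \<open>{\<omega>. X t \<omega> \<noteq> \<Delta>}\<close> implements the convention \<open>f \<Delta> = 0\<close>.\<close>

definition transition_op ::
    "('s \<Rightarrow> 'w measure) \<Rightarrow> (ennreal \<Rightarrow> 'w \<Rightarrow> 's) \<Rightarrow> 's \<Rightarrow> ennreal \<Rightarrow> ('s \<Rightarrow> real) \<Rightarrow> 's \<Rightarrow> real" where
  "transition_op P X \<Delta> t f x = (LINT \<omega>:{\<omega>. X t \<omega> \<noteq> \<Delta>}|P x. f (X t \<omega>))"

definition L2 :: "'s measure \<Rightarrow> ('s \<Rightarrow> real) set" where
  "L2 m = {f \<in> borel_measurable m. integrable m (\<lambda>x. (f x)\<^sup>2)}"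

text \<open>
  The operators are everywhere defined on \<open>L2 m\<close> (the defining expectation exists almost everywhere
  and the result is square integrable), so self-adjointness is symmetry.
\<close>

definition self_dual ::
    "('s \<Rightarrow> 'w measure) \<Rightarrow> (ennreal \<Rightarrow> 'w \<Rightarrow> 's) \<Rightarrow> 's \<Rightarrow> 's measure \<Rightarrow> bool" where
  "self_dual P X \<Delta> m \<longleftrightarrow> (\<forall>t<\<infinity>.
     (\<forall>f\<in>L2 m. (AE x in m. set_integrable (P x) {\<omega>. X t \<omega> \<noteq> \<Delta>} (\<lambda>\<omega>. f (X t \<omega>))) \<and>
        transition_op P X \<Delta> t f \<in> L2 m) \<and>
     (\<forall>f\<in>L2 m. \<forall>g\<in>L2 m.
        (LINT x|m. transition_op P X \<Delta> t f x * g x) =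
        (LINT x|m. f x * transition_op P X \<Delta> t g x)))"

section \<open>The Fleming--Viot system of two particles\<close>

text \<open>
  A realisation is a sequence \<open>w\<close> of pairs of sample points; \<open>w n\<close> drives the two independent copies
  of the process between the \<open>n\<close>-th and the \<open>(n+1)\<close>-st branching time (the former being time 0 if
  \<open>n = 0\<close>).
\<close>

definition fv_duration :: "(ennreal \<Rightarrow> 'w \<Rightarrow> 's) \<Rightarrow> 's \<Rightarrow> 'w \<times> 'w \<Rightarrow> ennreal" where
  "fv_duration X \<Delta> = (\<lambda>(\<omega>, \<omega>'). min (lifetime X \<Delta> \<omega>) (lifetime X \<Delta> \<omega>'))"

text \<open>
  The surviving position is \<open>\<Delta>\<close> if both lifetimes coincide, finite or not. The sequence is then
  continued from \<open>(\<Delta>, \<Delta>)\<close>, where all further durations are 0; hence the branching times stay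
  constant from that step on (equal to \<open>\<infinity>\<close> if the lifetimes are infinite), which is the convention
  for a construction that has stopped.
\<close>

definition fv_survivor :: "(ennreal \<Rightarrow> 'w \<Rightarrow> 's) \<Rightarrow> 's \<Rightarrow> 'w \<times> 'w \<Rightarrow> 's" where
  "fv_survivor X \<Delta> = (\<lambda>(\<omega>, \<omega>').
     if lifetime X \<Delta> \<omega>' < lifetime X \<Delta> \<omega> then X (lifetime X \<Delta> \<omega>') \<omega>
     else if lifetime X \<Delta> \<omega> < lifetime X \<Delta> \<omega>' then X (lifetime X \<Delta> \<omega>) \<omega>'
     else \<Delta>)"

primrec fv_kernel ::
    "('s \<Rightarrow> 'w measure) \<Rightarrow> (ennreal \<Rightarrow> 'w \<Rightarrow> 's) \<Rightarrow> 's \<Rightarrow> 's \<Rightarrow> 's \<Rightarrow>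
     nat \<Rightarrow> (nat \<Rightarrow> 'w \<times> 'w) \<Rightarrow> ('w \<times> 'w) measure" where
  "fv_kernel P X \<Delta> x y 0 w = P x \<Otimes>\<^sub>M P y"
| "fv_kernel P X \<Delta> x y (Suc n) w =
     P (fv_survivor X \<Delta> (w n)) \<Otimes>\<^sub>M P (fv_survivor X \<Delta> (w n))"

text \<open>For a Hunt process, these kernels meet the hypotheses of the Ionescu-Tulcea theorem.\<close>

context hunt_process
begin

lemma measurable_X_at:
  assumes T: "T \<in> borel_measurable N" and g: "g \<in> N \<rightarrow>\<^sub>M \<Omega>"
  shows "(\<lambda>v. X (T v) (g v)) \<in> borel_measurable N"
proof -
  define A where
    "A n t = (if t = \<infinity> then \<infinity> else ennreal (real_of_int (\<lfloor>enn2real t * 2^n\<rfloor> + 1) / 2^n))" for n :: nat and t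
  have Xc: "(\<lambda>v. X c (g v)) \<in> borel_measurable N" for c
    using g measurable_X by (rule measurable_compose)
  have 1: "(\<lambda>v. X (A n (T v)) (g v)) \<in> borel_measurable N" for n
  proof -
    have a: "(\<lambda>v. X (ennreal (real_of_int (\<lfloor>enn2real (T v) * 2^n\<rfloor> + 1) / 2^n)) (g v))
      \<in> borel_measurable N"
    proof (rule measurable_compose_countable[where
          f="\<lambda>i v. X (ennreal (real_of_int (i+1) / 2^n)) (g v)" and g="\<lambda>v. \<lfloor>enn2real (T v) * 2^n\<rfloor>"])
      show "(\<lambda>v. \<lfloor>enn2real (T v) * 2 ^ n\<rfloor>) \<in> N \<rightarrow>\<^sub>M count_space UNIV" using T by measurable
    qed (rule Xc)
    have "(\<lambda>v. X (A n (T v)) (g v)) =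
      (\<lambda>v. if T v = \<infinity> then X \<infinity> (g v)
        else X (ennreal (real_of_int (\<lfloor>enn2real (T v) * 2^n\<rfloor> + 1) / 2^n)) (g v))"
      by (auto simp: A_def)
    moreover have "Measurable.pred N (\<lambda>v. T v = \<infinity>)" using T by measurable
    ultimately show ?thesis using a Xc[of \<infinity>] by (simp only:) (rule measurable_If, auto)
  qed
  show ?thesis
  proof (rule borel_measurable_LIMSEQ_metric[OF 1])
    fix v assume v: "v \<in> space N"
    then have gv: "g v \<in> space \<Omega>" using g by (auto dest: measurable_space)
    show "(\<lambda>n. X (A n (T v)) (g v)) \<longlonglongrightarrow> X (T v) (g v)"
    proof (cases "T v = \<infinity>")
      case True then show ?thesis by (simp add: A_def)
    next
      case False
      define t where "t = enn2real (T v)"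
      have t: "T v = ennreal t" "0 \<le> t" using False by (auto simp: t_def less_top)
      have lo: "t < real_of_int (\<lfloor>t * 2^n\<rfloor> + 1) / 2^n" for n
        by (simp add: field_simps) linarith
      have up: "real_of_int (\<lfloor>t * 2^n\<rfloor> + 1) / 2^n \<le> t + 1 / 2^n" for n
        by (simp add: field_simps)
      have "(\<lambda>n. t + (1/2)^n) \<longlonglongrightarrow> t + 0"
        by (intro tendsto_add tendsto_const LIMSEQ_realpow_zero) auto
      then have 2: "(\<lambda>n. t + 1 / 2^n) \<longlonglongrightarrow> t" by (simp add: power_one_over)
      have "(\<lambda>n. real_of_int (\<lfloor>t * 2^n\<rfloor> + 1) / 2^n) \<longlonglongrightarrow> t"
        by (rule real_tendsto_sandwich[OF _ _ tendsto_const 2])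
          (use lo up in \<open>auto intro!: always_eventually simp del: of_int_add intro: less_imp_le\<close>)
      then have "(\<lambda>n. A n (T v)) \<longlonglongrightarrow> T v"
        using False t by (simp add: A_def tendsto_ennrealI flip: t_def)
      moreover have "A n (T v) > T v" for n
        using False t lo[of n] by (simp add: A_def ennreal_less_iff flip: t_def)
      ultimately have "filterlim (\<lambda>n. A n (T v)) (at_right (T v)) sequentially"
        by (auto simp: filterlim_at less_imp_neq[symmetric] intro!: always_eventually)
      moreover have "((\<lambda>s. X s (g v)) \<longlongrightarrow> X (T v) (g v)) (at_right (T v))"
        using False gv by (intro right_continuous) (auto simp: less_top)
      ultimately show ?thesis by (rule filterlim_compose[rotated])
    qed
  qed
qed

lemma measurable_lifetime: "lifetime X \<Delta> \<in> borel_measurable \<Omega>"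
proof (rule borel_measurableI_le)
  fix t
  have "lifetime X \<Delta> \<omega> \<le> t \<longleftrightarrow> X t \<omega> = \<Delta>" if "\<omega> \<in> space \<Omega>" for \<omega>
    using absorbing[OF that, of t] by (auto simp: lifetime_def intro: Inf_lower)
  then have "{\<omega> \<in> space \<Omega>. lifetime X \<Delta> \<omega> \<le> t} = X t -` {\<Delta>} \<inter> space \<Omega>" by auto
  then show "{\<omega> \<in> space \<Omega>. lifetime X \<Delta> \<omega> \<le> t} \<in> sets \<Omega>"
    using measurable_sets[OF measurable_X, of "{\<Delta>}"] by simp
qed

lemma measurable_fv_survivor: "fv_survivor X \<Delta> \<in> borel_measurable (\<Omega> \<Otimes>\<^sub>M \<Omega>)"
proof -
  note measurable_lifetime[measurable] measurable_X_at[measurable]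
  show ?thesis unfolding fv_survivor_def split_beta by measurable
qed

lemma Ionescu_Tulcea_fv_kernel: "Ionescu_Tulcea (fv_kernel P X \<Delta> x y) (\<lambda>_. \<Omega> \<Otimes>\<^sub>M \<Omega>)"
proof (rule Ionescu_Tulcea.intro)
  note [measurable] = measurable_fv_survivor measurable_prob_algebraD[OF kernel]
  show "fv_kernel P X \<Delta> x y i \<in> Pi\<^sub>M {0..<i} (\<lambda>_. \<Omega> \<Otimes>\<^sub>M \<Omega>)
    \<rightarrow>\<^sub>M subprob_algebra (\<Omega> \<Otimes>\<^sub>M \<Omega>)" for i
  proof (cases i)
    case 0
    have [measurable]: "P x \<in> space (subprob_algebra \<Omega>)" "P y \<in> space (subprob_algebra \<Omega>)"
      using measurable_space[OF measurable_prob_algebraD[OF kernel]] by auto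
    then have "P x \<Otimes>\<^sub>M P y \<in> space (subprob_algebra (\<Omega> \<Otimes>\<^sub>M \<Omega>))"
      using measurable_space[OF measurable_pair_measure[of
          "\<lambda>_. P x" "count_space UNIV" \<Omega> "\<lambda>_. P y" \<Omega>]] by simp
    then show ?thesis unfolding 0 fv_kernel.simps by simp
  next
    case (Suc n)
    have "fv_kernel P X \<Delta> x y (Suc n) =
      (\<lambda>w. P (fv_survivor X \<Delta> (w n)) \<Otimes>\<^sub>M P (fv_survivor X \<Delta> (w n)))" by auto
    moreover have "(\<lambda>w. P (fv_survivor X \<Delta> (w n)))
      \<in> Pi\<^sub>M {0..<Suc n} (\<lambda>_. \<Omega> \<Otimes>\<^sub>M \<Omega>) \<rightarrow>\<^sub>M subprob_algebra \<Omega>"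
      by (rule measurable_compose[OF measurable_compose[OF
          measurable_component_singleton[where M="\<lambda>_. \<Omega> \<Otimes>\<^sub>M \<Omega>" and i=n]
          measurable_fv_survivor] measurable_prob_algebraD[OF kernel]]) simp
    ultimately show ?thesis unfolding Suc by (simp add: measurable_pair_measure)
  qed
  have pr: "prob_space (P z)" for z
    using measurable_space[OF kernel, of z] by (simp add: space_prob_algebra)
  show "prob_space (fv_kernel P X \<Delta> x y i w)"
    if "w \<in> space (Pi\<^sub>M {0..<i} (\<lambda>_. \<Omega> \<Otimes>\<^sub>M \<Omega>))" for i w
    by (cases i) (auto intro!: prob_space_pair pr)
qed
end

text \<open>
  The law of the system started at \<open>(x, y)\<close> is the measure with these conditional laws given by the
  Ionescu-Tulcea theorem.
\<close>

definition fv_law ::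
    "'w measure \<Rightarrow> ('s \<Rightarrow> 'w measure) \<Rightarrow> (ennreal \<Rightarrow> 'w \<Rightarrow> 's) \<Rightarrow> 's \<Rightarrow> 's \<Rightarrow> 's \<Rightarrow>
     (nat \<Rightarrow> 'w \<times> 'w) measure" where
  "fv_law \<Omega> P X \<Delta> x y =
     projective_family.lim UNIV
       (Ionescu_Tulcea.CI (fv_kernel P X \<Delta> x y) (\<lambda>_. \<Omega> \<Otimes>\<^sub>M \<Omega>)) (\<lambda>_. \<Omega> \<Otimes>\<^sub>M \<Omega>)"

primrec branching_time ::
    "(ennreal \<Rightarrow> 'w \<Rightarrow> 's) \<Rightarrow> 's \<Rightarrow> nat \<Rightarrow> (nat \<Rightarrow> 'w \<times> 'w) \<Rightarrow> ennreal" where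
  "branching_time X \<Delta> 0 w = 0"
| "branching_time X \<Delta> (Suc n) w = branching_time X \<Delta> n w + fv_duration X \<Delta> (w n)"

definition limit_branching_time ::
    "(ennreal \<Rightarrow> 'w \<Rightarrow> 's) \<Rightarrow> 's \<Rightarrow> (nat \<Rightarrow> 'w \<times> 'w) \<Rightarrow> ennreal" where
  "limit_branching_time X \<Delta> w = lim (\<lambda>n. branching_time X \<Delta> n w)"

end

theory Submission
  imports Defs
begin

text \<open>
  Let two independent copies start at the same point, itself distributed according to \<open>m\<close>. By
  self-duality, reversing the path of the survivor up to the death of the other copy and continuing
  with the path of the other copy gives a single path that starts at the survivor's position \<open>Z\<close>, is
  governed by \<open>m\<close> and the laws \<open>P z\<close>, and has lifetime \<open>2 \<sigma>\<close>. Hence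
  \<open>\<integral> m(dx) E\<^sup>x\<^sup>,\<^sup>x[e\<^bsup>-\<sigma>\<^esup> f(Z)] = \<integral> m(dz) f(z) E\<^sup>z[e\<^bsup>-\<zeta>/2\<^esup>]\<close>. Now \<open>E\<^sup>x\<^sup>,\<^sup>x[e\<^bsup>-\<tau>\<^esup>]\<close>, with \<open>\<tau>\<close> the
  extinction time, is at most the largest function \<open>h \<le> 1\<close> with \<open>h(x) = E\<^sup>x\<^sup>,\<^sup>x[e\<^bsup>-\<sigma>\<^esup> h(Z)]\<close>. It
  satisfies \<open>\<integral> h(z) m(dz) = \<integral> h(z) E\<^sup>z[e\<^bsup>-\<zeta>/2\<^esup>] m(dz)\<close>, and since \<open>m\<close> is finite and \<open>\<zeta> > 0\<close>, this forces
  \<open>h = 0\<close> almost everywhere. If the starting points are distributed according to \<open>m \<times> m\<close>, the law of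
  the first survivor's position is absolutely continuous with respect to \<open>m\<close>, so that \<open>h\<close> vanishes there
  almost surely.
\<close>

section \<open>Discounting, Ionescu-Tulcea measures and measures on metric spaces\<close>

text \<open>The value 0 at infinity makes a random time almost surely infinite as soon as its
  expected discount vanishes; non-extinction is proved in this form.\<close>

definition neg_exp :: "ennreal \<Rightarrow> ennreal" where
  "neg_exp t = (if t = \<infinity> then 0 else ennreal (exp (- enn2real t)))"

lemma neg_exp_ennreal: "0 \<le> r \<Longrightarrow> neg_exp (ennreal r) = ennreal (exp (- r))"
  by (simp add: neg_exp_def)

lemma neg_exp_0 [simp]: "neg_exp 0 = 1"
  by (simp add: neg_exp_def)

lemma neg_exp_top [simp]: "neg_exp \<top> = 0"
  by (simp add: neg_exp_def)

lemma neg_exp_add: "neg_exp (s + t) = neg_exp s * neg_exp t"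
  by (cases s; cases t) (simp_all add: neg_exp_ennreal mult_exp_exp flip: ennreal_plus ennreal_mult)

lemma neg_exp_le_1: "neg_exp t \<le> 1"
  by (cases t) (simp_all add: neg_exp_ennreal)

lemma neg_exp_less_1: "0 < t \<Longrightarrow> neg_exp t < 1"
  by (cases t) (simp_all add: neg_exp_ennreal ennreal_less_one_iff)

lemma neg_exp_eq_0_iff: "neg_exp t = 0 \<longleftrightarrow> t = \<infinity>"
  by (cases t) (simp_all add: neg_exp_ennreal)

lemma measurable_neg_exp [measurable]: "neg_exp \<in> borel_measurable borel"
  unfolding neg_exp_def by measurable

lemma neg_exp_antimono: "s \<le> t \<Longrightarrow> neg_exp t \<le> neg_exp s"
  by (cases s; cases t) (simp_all add: neg_exp_ennreal top_unique)

section \<open>Integration against Ionescu-Tulcea measures\<close>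

text \<open>The projective limit restricts to \<open>CI {0..<n}\<close>, which is an image of
  \<open>C 0 (up_to {0..<n})\<close>, and \<open>up_to {0..<n}\<close> is \<open>n\<close>. So only
  the first \<open>n\<close> kernels enter.\<close>

lemma (in Ionescu_Tulcea) nn_integral_lim_restrict:
  assumes G: "G \<in> borel_measurable (PiM {0..<n} M)"
  shows "(\<integral>\<^sup>+w. G (restrict w {0..<n}) \<partial>PF.lim) = (\<integral>\<^sup>+w. G w \<partial>C 0 n (\<lambda>_. undefined))"
proof -
  have "(\<integral>\<^sup>+w. G (restrict w {0..<n}) \<partial>PF.lim) = integral\<^sup>N (CI {0..<n}) G"
    unfolding distr_lim[OF finite_atLeastLessThan, symmetric]
    by (rule nn_integral_distr[symmetric])
       (simp_all add: G measurable_cong_sets[OF PF.sets_lim refl] measurable_restrict_subset del: restrict_apply)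
  also have "\<dots> = (\<integral>\<^sup>+w. G (restrict w {0..<n}) \<partial>C 0 (up_to {0..<n}) (\<lambda>_. undefined))"
    unfolding CI_def
  proof (rule nn_integral_distr)
    have "{0..<n} \<subseteq> {0..<up_to {0..<n}}" by (rule up_to) simp
    then show "(\<lambda>f. restrict f {0..<n}) \<in> C 0 (up_to {0..<n}) (\<lambda>x. undefined) \<rightarrow>\<^sub>M PiM {0..<n} M"
      by (intro measurable_cong_sets[THEN equalityD2, THEN subsetD, OF sets_C refl])
        (auto intro!: measurable_restrict simp: space_PiM)
  qed (use G in simp)
  also have "up_to {0..<n} = n"
    by (rule antisym) (auto simp: up_to_iff_Ico, metis atLeastLessThan_iff finite_atLeastLessThan
        less_irrefl not_le up_to_less zero_le)
  also have "(\<integral>\<^sup>+w. G (restrict w {0..<n}) \<partial>C 0 n (\<lambda>_. undefined)) = (\<integral>\<^sup>+w. G w \<partial>C 0 n (\<lambda>_. undefined))"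
    by (rule nn_integral_cong) (auto simp: space_C space_PiM)
  finally show ?thesis .
qed

lemma (in Ionescu_Tulcea) prob_space_lim: "prob_space PF.lim"
proof (rule prob_spaceI)
  have "(\<integral>\<^sup>+w. 1 \<partial>PF.lim) = (\<integral>\<^sup>+w. 1 \<partial>C 0 0 (\<lambda>_. undefined))"
    by (rule nn_integral_lim_restrict) simp
  then show "emeasure PF.lim (space PF.lim) = 1"
    using prob_space.emeasure_space_1[OF prob_space_C[of "\<lambda>_. undefined" 0 0]]
    by (simp add: space_PiM)
qed

text \<open>Disintegration over the last coordinate: \<open>C 0 (Suc n)\<close> is
  \<open>C 0 n\<close> followed by \<open>eP n\<close>, which appends a coordinate drawn from
  \<open>P n\<close>. This gives the recursion over the branching times.\<close>

lemma (in Ionescu_Tulcea) nn_integral_lim_Suc: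
  assumes G [measurable]: "G \<in> borel_measurable (PiM {0..<Suc n} M)"
  shows "(\<integral>\<^sup>+w. G (restrict w {0..<Suc n}) \<partial>PF.lim) =
    (\<integral>\<^sup>+w. (\<integral>\<^sup>+v. G ((restrict w {0..<n})(n := v)) \<partial>P n (restrict w {0..<n})) \<partial>PF.lim)"
proof -
  let ?u = "\<lambda>_. undefined :: 'a"
  have u: "?u \<in> space (PiM {0..<0} M)" by (simp add: space_PiM)
  define g where "g w = integral\<^sup>N (eP n w) G" for w
  have g [measurable]: "g \<in> borel_measurable (PiM {0..<n} M)"
    unfolding g_def by (rule measurable_compose[OF measurable_eP nn_integral_measurable_subprob_algebra]) simp
  have geq: "g w = (\<integral>\<^sup>+v. G (w(n := v)) \<partial>P n w)" if "w \<in> space (PiM {0..<n} M)" for w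
    unfolding g_def using that by (rule nn_integral_eP) simp
  have "(\<integral>\<^sup>+w. G (restrict w {0..<Suc n}) \<partial>PF.lim) = integral\<^sup>N (C 0 n ?u \<bind> eP n) G"
    using nn_integral_lim_restrict[OF G] by simp
  also have "\<dots> = integral\<^sup>N (C 0 n ?u) g"
    unfolding g_def
    by (rule nn_integral_bind[where B="PiM {0..<Suc n} M"])
      (use u in \<open>simp_all add: measurable_cong_sets[OF sets_C refl]\<close>)
  also have "\<dots> = (\<integral>\<^sup>+w. g (restrict w {0..<n}) \<partial>PF.lim)"
    by (rule nn_integral_lim_restrict[symmetric]) simp
  also have "\<dots> = (\<integral>\<^sup>+w. (\<integral>\<^sup>+v. G ((restrict w {0..<n})(n := v)) \<partial>P n (restrict w {0..<n})) \<partial>PF.lim)"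
    by (rule nn_integral_cong, rule geq) (auto simp: space_PiM)
  finally show ?thesis .
qed

section \<open>Finite Borel measures are determined by continuous functions\<close>

text \<open>Off a closed set the distance to it is positive, so a steep enough slope brings the
  function down to 0. The set is nonempty because \<open>infdist x {}\<close> is 0.\<close>

lemma indicator_closed_continuous_limit:
  fixes C :: "'a::metric_space set"
  assumes "closed C" "C \<noteq> {}"
  shows "(\<lambda>n. max 0 (1 - real n * infdist x C)) \<longlonglongrightarrow> indicator C x"
proof (cases "x \<in> C")
  case True then show ?thesis by simp
next
  case False
  then have d: "0 < infdist x C" using assms by (simp add: infdist_pos_not_in_closed)
  obtain N where N: "1 < real N * infdist x C" using reals_Archimedean3[OF d] by blast
  have "1 - real n * infdist x C \<le> 0" if "N \<le> n" for n
    using N mult_right_mono[of "real N" "real n" "infdist x C"] that d by linarith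
  then have "\<forall>\<^sub>F n in sequentially. max 0 (1 - real n * infdist x C) = 0"
    unfolding eventually_sequentially by (intro exI[of _ N] allI impI max_absorb1)
  then show ?thesis using False by (simp add: tendsto_eventually)
qed

text \<open>Closed sets form an intersection-stable generator, and dominated convergence recovers
  their measures from continuous functions. The duality identity can thus be proved first for
  continuous functions, where right-continuous paths can be followed to a limit.\<close>

lemma borel_measure_eqI_continuous:
  fixes M N :: "'a::metric_space measure"
  assumes sets: "sets M = sets borel" "sets N = sets borel"
    and fin: "finite_measure M" "finite_measure N"
    and eq: "\<And>f :: 'a \<Rightarrow> real. continuous_on UNIV f \<Longrightarrow> (\<And>x. 0 \<le> f x \<and> f x \<le> 1) \<Longrightarrow>
      (\<integral>\<^sup>+x. ennreal (f x) \<partial>M) = (\<integral>\<^sup>+x. ennreal (f x) \<partial>N)"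
  shows "M = N"
proof (rule measure_eqI_generator_eq[where E="Collect closed" and \<Omega>=UNIV and A="\<lambda>_. UNIV"])
  show "Int_stable (Collect closed)" by (auto simp: Int_stable_def)
  show "sets M = sigma_sets UNIV (Collect closed)" "sets N = sigma_sets UNIV (Collect closed)"
    using sets unfolding borel_eq_closed by simp_all
  show "emeasure M UNIV \<noteq> \<infinity>" using fin(1) by (simp add: finite_measure.emeasure_finite)
  fix C :: "'a set" assume "C \<in> Collect closed"
  then have C: "closed C" by simp
  show "emeasure M C = emeasure N C"
  proof (cases "C = {}")
    case False
    define f where "f n x = max 0 (1 - real n * infdist x C)" for n x
    have c: "continuous_on UNIV (f n)" for n
      unfolding f_def by (intro continuous_intros)
    have b: "0 \<le> f n x \<and> f n x \<le> 1" for n x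
      by (simp add: f_def infdist_nonneg)
    have lim: "(\<lambda>n. \<integral>\<^sup>+x. ennreal (f n x) \<partial>K) \<longlonglongrightarrow> emeasure K C"
      if K: "sets K = sets borel" and fin: "finite_measure K" for K :: "'a measure"
    proof -
      interpret finite_measure K by fact
      have [measurable]: "f n \<in> borel_measurable K" for n
        unfolding measurable_cong_sets[OF K refl] using c by (rule borel_measurable_continuous_onI)
      have [measurable]: "C \<in> sets K" using C K by simp
      have "(\<lambda>n. \<integral>\<^sup>+x. ennreal (f n x) \<partial>K) \<longlonglongrightarrow> (\<integral>\<^sup>+x. ennreal (indicator C x) \<partial>K)"
      proof (rule nn_integral_dominated_convergence[where w="\<lambda>_. 1"])
        show "AE x in K. (\<lambda>i. ennreal (f i x)) \<longlonglongrightarrow> ennreal (indicator C x)"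
          unfolding f_def using indicator_closed_continuous_limit[OF C False]
          by (intro AE_I2 tendsto_ennrealI)
        show "AE x in K. ennreal (f j x) \<le> 1" for j
          using b[of j] by (intro AE_I2) simp
      qed (simp_all add: less_top[symmetric])
      then show ?thesis by (simp add: ennreal_indicator)
    qed
    show ?thesis
      using lim[OF sets(1) fin(1)] lim[OF sets(2) fin(2)] eq[OF c b] LIMSEQ_unique by auto
  qed simp
qed auto

section \<open>The semigroup of a Hunt process\<close>

context hunt_process
begin

lemma measurable_P [measurable]: "P \<in> borel \<rightarrow>\<^sub>M subprob_algebra \<Omega>"
  using kernel by (rule measurable_prob_algebraD)

lemma prob_space_P: "prob_space (P x)"
  using measurable_space[OF kernel, of x] by (simp add: space_prob_algebra)

lemma sets_P [simp, measurable_cong]: "sets (P x) = sets \<Omega>"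
  using measurable_space[OF kernel, of x] by (simp add: space_prob_algebra)

lemma space_P [simp]: "space (P x) = space \<Omega>"
  by (rule sets_eq_imp_space_eq) simp

lemma emeasure_P_le_1: "emeasure (P x) A \<le> 1"
  by (rule prob_space.measure_le_1[OF prob_space_P])

lemma emeasure_P_space [simp]: "emeasure (P x) (space \<Omega>) = 1"
  using prob_space.emeasure_space_1[OF prob_space_P] by simp

declare measurable_lifetime [measurable] measurable_X [measurable]

lemma alive_iff: "\<omega> \<in> space \<Omega> \<Longrightarrow> X t \<omega> \<noteq> \<Delta> \<longleftrightarrow> t < lifetime X \<Delta> \<omega>"
  using absorbing[of \<omega> t] by (auto simp: lifetime_def not_le[symmetric] intro: Inf_lower)

lemma AE_lifetime_pos: "x \<noteq> \<Delta> \<Longrightarrow> AE \<omega> in P x. 0 < lifetime X \<Delta> \<omega>"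
  using normal[of x] AE_space[of "P x"] by eventually_elim (auto simp flip: alive_iff)

section \<open>Transition operators and survival probabilities\<close>

text \<open>The counterpart of \<open>transition_op\<close> for nonnegative functions, with extended
  values so that integrability never has to be checked. The indicator is the convention that
  functions vanish at the cemetery.\<close>

definition killed_semigroup :: "ennreal \<Rightarrow> ('s \<Rightarrow> ennreal) \<Rightarrow> 's \<Rightarrow> ennreal" where
  "killed_semigroup t f x = (\<integral>\<^sup>+\<omega>. f (X t \<omega>) * indicator (- {\<Delta>}) (X t \<omega>) \<partial>P x)"

definition survival :: "ennreal \<Rightarrow> 's \<Rightarrow> ennreal" where
  "survival t x = emeasure (P x) {\<omega> \<in> space \<Omega>. t < lifetime X \<Delta> \<omega>}"

definition death_in :: "ennreal \<Rightarrow> ennreal \<Rightarrow> 's \<Rightarrow> ennreal" where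
  "death_in s t x = emeasure (P x) {\<omega> \<in> space \<Omega>. lifetime X \<Delta> \<omega> \<in> {s<..t}}"

lemma measurable_semigroup [measurable]:
  assumes [measurable]: "f \<in> borel_measurable borel"
  shows "killed_semigroup t f \<in> borel_measurable borel"
  unfolding killed_semigroup_def by measurable

lemma measurable_survival [measurable]: "survival t \<in> borel_measurable borel"
  unfolding survival_def by measurable

lemma measurable_death_in [measurable]: "death_in s t \<in> borel_measurable borel"
  unfolding death_in_def by measurable

lemma survival_le_1: "survival t x \<le> 1"
  unfolding survival_def by (rule emeasure_P_le_1)

lemma semigroup_le_1: 
  assumes "\<And>x. f x \<le> 1" shows "killed_semigroup t f x \<le> 1"
proof -
  have "killed_semigroup t f x \<le> (\<integral>\<^sup>+\<omega>. 1 \<partial>P x)"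
    unfolding killed_semigroup_def by (intro nn_integral_mono) (use assms in \<open>auto split: split_indicator\<close>)
  then show ?thesis by simp
qed

lemma survival_decompose: "s \<le> t \<Longrightarrow> survival s x = death_in s t x + survival t x"
  unfolding survival_def death_in_def
  by (subst plus_emeasure) (auto intro!: arg_cong[where f="emeasure (P x)"])

lemma death_in_add: "s \<le> t \<Longrightarrow> t \<le> u \<Longrightarrow> death_in s t x + death_in t u x = death_in s u x"
  unfolding death_in_def
  by (subst plus_emeasure) (auto intro!: arg_cong[where f="emeasure (P x)"])

lemma survival_eq_semigroup: "survival t x = killed_semigroup t (\<lambda>_. 1) x"
proof -
  have "(\<integral>\<^sup>+\<omega>. 1 * indicator (- {\<Delta>}) (X t \<omega>) \<partial>P x) =
    (\<integral>\<^sup>+\<omega>. indicator {\<omega> \<in> space \<Omega>. t < lifetime X \<Delta> \<omega>} \<omega> \<partial>P x)"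
    by (intro nn_integral_cong) (auto simp: alive_iff split: split_indicator)
  then show ?thesis unfolding survival_def killed_semigroup_def by simp
qed

lemma survival_cemetery: "survival t \<Delta> = 0"
proof -
  have "AE \<omega> in P \<Delta>. \<not> t < lifetime X \<Delta> \<omega>"
    using normal[of \<Delta>] AE_space[of "P \<Delta>"]
  proof eventually_elim
    case (elim \<omega>)
    then have "\<not> 0 < lifetime X \<Delta> \<omega>" using alive_iff[of \<omega> 0] by simp
    then show ?case by (simp add: not_less)
  qed
  then show ?thesis unfolding survival_def
    using AE_iff_measurable[of "{\<omega> \<in> space \<Omega>. t < lifetime X \<Delta> \<omega>}" "P \<Delta>"
        "\<lambda>\<omega>. \<not> t < lifetime X \<Delta> \<omega>"] by simp
qed

text \<open>The Markov property at a deterministic time, obtained from \<open>strong_Markov\<close>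
  with a constant stopping time.\<close>

lemma semigroup_survival: "killed_semigroup s (survival t) x = survival (s + t) x"
proof -
  interpret F: filtration "space \<Omega>" "right_filtration \<Omega> X" by (rule filtration_right_filtration)
  have T: "stopping_time (right_filtration \<Omega> X) (\<lambda>_. s)" by (rule stopping_time_const)
  have "{\<omega> \<in> space \<Omega>. s \<le> t} \<in> sets (right_filtration \<Omega> X t)" for t
    using sets.top[of "right_filtration \<Omega> X t"] by (cases "s \<le> t") (simp_all add: F.space_F)
  then have top: "space \<Omega> \<in> sets (F.pre_sigma (\<lambda>_. s))"
    by (intro F.sets_pre_sigmaI[OF T])
  have alive: "{\<omega> \<in> space \<Omega>. X t \<omega> \<in> - {\<Delta>}} = {\<omega> \<in> space \<Omega>. t < lifetime X \<Delta> \<omega>}" for t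
    by (simp add: alive_iff cong: conj_cong)
  have "survival (s + t) x = (\<integral>\<^sup>+\<omega>\<in>space \<Omega>. survival t (X s \<omega>) \<partial>P x)"
    using strong_Markov[OF T top, of "- {\<Delta>}" x t] unfolding alive survival_def by simp
  \<comment> \<open>Restricting to living paths loses nothing, since \<open>survival t\<close>
    vanishes at the cemetery.\<close>
  also have "\<dots> = killed_semigroup s (survival t) x"
    unfolding killed_semigroup_def
    by (intro nn_integral_cong) (auto simp: survival_cemetery split: split_indicator)
  finally show ?thesis ..
qed

end

section \<open>Symmetry with respect to the reference measure\<close>

text \<open>The working form of self-duality. The measure lives on the whole extended state space,
  with the cemetery as a null set, and symmetry is expressed by nonnegative integrals of functions
  bounded by 1.\<close>

locale symmetric_hunt_process = hunt_process \<Omega> P X \<Delta>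
  for \<Omega> :: "'w measure" and P :: "'s::{metric_space, second_countable_topology} \<Rightarrow> 'w measure"
    and X \<Delta> +
  fixes \<mu> :: "'s measure"
  assumes sets_\<mu> [simp, measurable_cong]: "sets \<mu> = sets borel"
    and finite_\<mu>: "finite_measure \<mu>"
    and AE_ne_cemetery: "AE x in \<mu>. x \<noteq> \<Delta>"
    and semigroup_symmetric:
      "t < \<infinity> \<Longrightarrow> f \<in> borel_measurable borel \<Longrightarrow> g \<in> borel_measurable borel \<Longrightarrow>
       (\<And>x. f x \<le> 1) \<Longrightarrow> (\<And>x. g x \<le> 1) \<Longrightarrow>
       (\<integral>\<^sup>+x. killed_semigroup t f x * g x \<partial>\<mu>) = (\<integral>\<^sup>+x. f x * killed_semigroup t g x \<partial>\<mu>)"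
begin

lemma space_\<mu> [simp]: "space \<mu> = UNIV"
  using sets_eq_imp_space_eq[OF sets_\<mu>] by simp

sublocale \<mu>: finite_measure \<mu> by (rule finite_\<mu>)

lemma nn_integral_le_1_finite:
  assumes "\<And>x. f x \<le> 1" shows "(\<integral>\<^sup>+x. f x \<partial>\<mu>) < \<infinity>"
proof -
  have "(\<integral>\<^sup>+x. f x \<partial>\<mu>) \<le> (\<integral>\<^sup>+x. 1 \<partial>\<mu>)" using assms by (intro nn_integral_mono)
  also have "\<dots> < \<infinity>" by (simp add: \<mu>.emeasure_finite less_top[symmetric])
  finally show ?thesis .
qed

lemma nn_integral_semigroup_survival:
  assumes [measurable]: "f \<in> borel_measurable borel" and f: "\<And>x. f x \<le> 1" and s: "s < \<infinity>"
  shows "(\<integral>\<^sup>+x. killed_semigroup s f x * survival t x \<partial>\<mu>) = (\<integral>\<^sup>+x. f x * survival (s + t) x \<partial>\<mu>)"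
  by (subst semigroup_symmetric[OF s]) (simp_all add: f survival_le_1 semigroup_survival)

text \<open>The analytic form of path reversal: a path run backwards for time \<open>s\<close>,
  followed by one that dies in \<open>(a, b]\<close>, weighs as much as one path that dies in
  \<open>(s + a, s + b]\<close>. A death probability is a difference of survival probabilities, for
  which this is symmetry plus the Markov property; the difference is taken by cancelling a finite
  integral.\<close>

lemma nn_integral_semigroup_death_in:
  assumes [measurable]: "f \<in> borel_measurable borel" and f: "\<And>x. f x \<le> 1" and s: "s < \<infinity>"
    and ab: "a \<le> b"
  shows "(\<integral>\<^sup>+x. killed_semigroup s f x * death_in a b x \<partial>\<mu>) = (\<integral>\<^sup>+x. f x * death_in (s + a) (s + b) x \<partial>\<mu>)"
proof -
  have sab: "s + a \<le> s + b" using ab by (rule add_left_mono)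
  have "(\<integral>\<^sup>+x. killed_semigroup s f x * survival b x \<partial>\<mu>) + (\<integral>\<^sup>+x. killed_semigroup s f x * death_in a b x \<partial>\<mu>) =
      (\<integral>\<^sup>+x. killed_semigroup s f x * survival a x \<partial>\<mu>)"
    unfolding survival_decompose[OF ab]
    by (subst nn_integral_add[symmetric]) (simp_all add: distrib_left add.commute)
  also have "\<dots> = (\<integral>\<^sup>+x. f x * survival (s + a) x \<partial>\<mu>)"
    by (rule nn_integral_semigroup_survival) (simp_all add: f s[simplified])
  also have "\<dots> = (\<integral>\<^sup>+x. f x * survival (s + b) x \<partial>\<mu>) + (\<integral>\<^sup>+x. f x * death_in (s + a) (s + b) x \<partial>\<mu>)"
    unfolding survival_decompose[OF sab]
    by (subst nn_integral_add[symmetric]) (simp_all add: distrib_left add.commute)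
  also have "(\<integral>\<^sup>+x. f x * survival (s + b) x \<partial>\<mu>) = (\<integral>\<^sup>+x. killed_semigroup s f x * survival b x \<partial>\<mu>)"
    by (rule nn_integral_semigroup_survival[symmetric]) (simp_all add: f s[simplified])
  finally have "(\<integral>\<^sup>+x. killed_semigroup s f x * survival b x \<partial>\<mu>) = \<top> \<or>
      (\<integral>\<^sup>+x. killed_semigroup s f x * death_in a b x \<partial>\<mu>) = (\<integral>\<^sup>+x. f x * death_in (s + a) (s + b) x \<partial>\<mu>)"
    by (simp add: ennreal_add_left_cancel)
  moreover have "(\<integral>\<^sup>+x. killed_semigroup s f x * survival b x \<partial>\<mu>) < \<infinity>"
    by (intro nn_integral_le_1_finite mult_le_one semigroup_le_1 f survival_le_1) simp
  ultimately show ?thesis by auto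
qed

definition path_law :: "'w measure" where
  "path_law = \<mu> \<bind> P"

text \<open>The paths are independent only given their common starting point, so this is not the
  square of \<open>path_law\<close>. The total mass is that of \<open>\<mu>\<close>, without
  normalisation.\<close>

definition pair_law :: "('w \<times> 'w) measure" where
  "pair_law = \<mu> \<bind> (\<lambda>x. P x \<Otimes>\<^sub>M P x)"

lemma measurable_diagonal [measurable]: "(\<lambda>x. P x \<Otimes>\<^sub>M P x) \<in> borel \<rightarrow>\<^sub>M subprob_algebra (\<Omega> \<Otimes>\<^sub>M \<Omega>)"
  by (rule measurable_pair_measure) measurable

lemma sets_path_law [simp, measurable_cong]: "sets path_law = sets \<Omega>"
  unfolding path_law_def by (rule sets_bind) simp_all

lemma sets_pair_law [simp, measurable_cong]: "sets pair_law = sets (\<Omega> \<Otimes>\<^sub>M \<Omega>)"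
  unfolding pair_law_def by (rule sets_bind) (auto intro!: sets_pair_measure_cong)

lemma space_path_law [simp]: "space path_law = space \<Omega>"
  by (rule sets_eq_imp_space_eq) simp

lemma space_pair_law [simp]: "space pair_law = space (\<Omega> \<Otimes>\<^sub>M \<Omega>)"
  by (rule sets_eq_imp_space_eq) simp

lemma nn_integral_path_law:
  "f \<in> borel_measurable \<Omega> \<Longrightarrow> (\<integral>\<^sup>+\<omega>. f \<omega> \<partial>path_law) = (\<integral>\<^sup>+x. (\<integral>\<^sup>+\<omega>. f \<omega> \<partial>P x) \<partial>\<mu>)"
  unfolding path_law_def by (rule nn_integral_bind[where B=\<Omega>]) (simp_all add: measurable_cong_sets[OF sets_\<mu> refl] measurable_P)

lemma nn_integral_pair_law:
  assumes [measurable]: "f \<in> borel_measurable (\<Omega> \<Otimes>\<^sub>M \<Omega>)"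
  shows "(\<integral>\<^sup>+v. f v \<partial>pair_law) = (\<integral>\<^sup>+x. (\<integral>\<^sup>+\<omega>. (\<integral>\<^sup>+\<omega>'. f (\<omega>, \<omega>') \<partial>P x) \<partial>P x) \<partial>\<mu>)"
proof -
  have "(\<integral>\<^sup>+v. f v \<partial>pair_law) = (\<integral>\<^sup>+x. (\<integral>\<^sup>+v. f v \<partial>(P x \<Otimes>\<^sub>M P x)) \<partial>\<mu>)"
    unfolding pair_law_def
    by (rule nn_integral_bind[where B="\<Omega> \<Otimes>\<^sub>M \<Omega>"])
      (simp_all add: assms measurable_diagonal measurable_cong_sets[OF sets_\<mu> refl])
  also have "\<dots> = (\<integral>\<^sup>+x. (\<integral>\<^sup>+\<omega>. (\<integral>\<^sup>+\<omega>'. f (\<omega>, \<omega>') \<partial>P x) \<partial>P x) \<partial>\<mu>)"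
  proof (rule nn_integral_cong)
    fix x
    interpret prob_space "P x" by (rule prob_space_P)
    show "(\<integral>\<^sup>+v. f v \<partial>(P x \<Otimes>\<^sub>M P x)) = (\<integral>\<^sup>+\<omega>. (\<integral>\<^sup>+\<omega>'. f (\<omega>, \<omega>') \<partial>P x) \<partial>P x)"
      by (rule nn_integral_fst[symmetric]) simp
  qed
  finally show ?thesis .
qed

lemma finite_path_law: "finite_measure path_law"
proof (rule finite_measureI)
  have "emeasure path_law (space path_law) = (\<integral>\<^sup>+x. emeasure (P x) (space (P x)) \<partial>\<mu>)"
    using nn_integral_path_law[of "\<lambda>_. 1"] by simp
  then show "emeasure path_law (space path_law) \<noteq> \<infinity>"
    by (simp add: \<mu>.emeasure_finite)
qed

lemma finite_pair_law: "finite_measure pair_law"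
proof (rule finite_measureI)
  have "emeasure pair_law (space pair_law) =
      (\<integral>\<^sup>+x. emeasure (P x) (space (P x)) * emeasure (P x) (space (P x)) \<partial>\<mu>)"
    using nn_integral_pair_law[of "\<lambda>_. 1"] by simp
  then show "emeasure pair_law (space pair_law) \<noteq> \<infinity>"
    by (simp add: \<mu>.emeasure_finite)
qed

end

section \<open>The position of the survivor\<close>

text \<open>Closed on the right, so that the right end of the cell of \<open>t\<close> is never
  before \<open>t\<close>, as the evaluation of right-continuous paths requires. Neither 0 nor
  infinity lies in a cell.\<close>

definition cell :: "real \<Rightarrow> nat \<Rightarrow> ennreal set" where
  "cell h k = {ennreal (real k * h)<..ennreal (real (Suc k) * h)}"

lemma cell_disjoint:
  assumes "0 < h" "t \<in> cell h j" "t \<in> cell h k" shows "j = k"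
proof -
  have "\<not> j < k" if "t \<in> cell h j" "t \<in> cell h k" for j k
  proof
    assume "j < k"
    then have "real (Suc j) * h \<le> real k * h" using assms(1) by (intro mult_right_mono) auto
    then have "ennreal (real (Suc j) * h) \<le> ennreal (real k * h)" by (rule ennreal_leI)
    then show False using that by (auto simp: cell_def simp del: ennreal_le_iff2)
  qed
  then show ?thesis using assms(2,3) by (metis linorder_neqE_nat)
qed

lemma suminf_cell_eq:
  fixes G :: "nat \<Rightarrow> ennreal"
  assumes "0 < h" "t \<in> cell h j"
  shows "(\<Sum>k. indicator (cell h k) t * G k) = G j"
proof -
  have "(\<Sum>k. indicator (cell h k) t * G k) = (\<Sum>k\<in>{j}. indicator (cell h k) t * G k)"
    by (rule suminf_finite) (use cell_disjoint[OF assms(1) _ assms(2)] in \<open>auto simp: indicator_def\<close>)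
  then show ?thesis using assms(2) by simp
qed

lemma suminf_cell_top: "(\<Sum>k. indicator (cell h k) \<top> * G k) = (0 :: ennreal)"
  by (simp add: cell_def top_unique)

lemma suminf_cell_le:
  fixes G :: "nat \<Rightarrow> ennreal"
  assumes "0 < h" "\<And>k. G k \<le> c"
  shows "(\<Sum>k. indicator (cell h k) t * G k) \<le> c"
proof (cases "\<exists>j. t \<in> cell h j")
  case True then show ?thesis using suminf_cell_eq[OF assms(1)] assms(2) by auto
next
  case False then show ?thesis by simp
qed

text \<open>Rounding up and subtracting 1, rather than rounding down, assigns a grid point to the
  cell that ends there.\<close>

definition cell_index :: "real \<Rightarrow> real \<Rightarrow> nat" where
  "cell_index h r = nat (\<lceil>r / h\<rceil> - 1)"

lemma cell_index:
  assumes "0 < h" "0 < r"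
  shows "real (cell_index h r) * h < r" "r \<le> real (Suc (cell_index h r)) * h"
    "ennreal r \<in> cell h (cell_index h r)"
proof -
  have "0 < \<lceil>r / h\<rceil>" using assms by simp
  then have k: "real (cell_index h r) = of_int \<lceil>r / h\<rceil> - 1"
    by (simp add: cell_index_def)
  have "of_int \<lceil>r / h\<rceil> - 1 < r / h" "r / h \<le> of_int \<lceil>r / h\<rceil>" by linarith+
  then have "(of_int \<lceil>r / h\<rceil> - 1) * h < r" "r \<le> of_int \<lceil>r / h\<rceil> * h"
    by (simp_all only: pos_less_divide_eq[OF assms(1)] pos_divide_le_eq[OF assms(1)])
  then show 1: "real (cell_index h r) * h < r" and 2: "r \<le> real (Suc (cell_index h r)) * h"
    by (simp_all add: k)
  show "ennreal r \<in> cell h (cell_index h r)"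
    using 1 2 assms unfolding cell_def by (simp add: ennreal_less_iff ennreal_le_iff2 del: of_nat_Suc)
qed

text \<open>The right end of a cell overshoots by less than the mesh. The rounded point may vary
  with \<open>n\<close>, because times shifted by the mesh itself are rounded later.\<close>

lemma tendsto_cell_index:
  assumes r: "r \<longlonglongrightarrow> l" "0 < l" and h: "h \<longlonglongrightarrow> 0" and pos: "\<And>n. 0 < h n"
  shows "(\<lambda>n. real (Suc (cell_index (h n) (r n))) * h n) \<longlonglongrightarrow> l"
proof (rule real_tendsto_sandwich[where f=r and h="\<lambda>n. r n + h n"])
  have ev: "\<forall>\<^sub>F n in sequentially. 0 < r n" using r by (rule order_tendstoD)
  show "(\<lambda>n. r n + h n) \<longlonglongrightarrow> l" using tendsto_add[OF r(1) h] by simp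
  show "\<forall>\<^sub>F n in sequentially. real (Suc (cell_index (h n) (r n))) * h n \<le> r n + h n"
    using ev
  proof eventually_elim
    case (elim n)
    show ?case using cell_index(1)[OF pos[of n] elim] by (simp add: algebra_simps)
  qed
  show "\<forall>\<^sub>F n in sequentially. r n \<le> real (Suc (cell_index (h n) (r n))) * h n"
    using ev by eventually_elim (rule cell_index(2)[OF pos])
qed (rule r)

text \<open>A cell of mesh \<open>2 * h\<close> shifted by \<open>h\<close> consists of two
  neighbouring cells of mesh \<open>h\<close>, the first with an odd left end. Truncated subtraction
  sends times up to \<open>h\<close> to 0, which lies in no cell.\<close>

lemma minus_mem_cell_iff:
  assumes "0 < h"
  shows "t - ennreal h \<in> cell (2 * h) k \<longleftrightarrow>
    t \<in> {ennreal (real (Suc (2 * k)) * h)<..ennreal (real (Suc (Suc (Suc (2 * k)))) * h)}"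
proof (cases t)
  case (real r)
  have "t - ennreal h = ennreal (r - h)" using real assms by (simp add: ennreal_minus)
  moreover have "ennreal (real k * (2 * h)) < ennreal (r - h) \<longleftrightarrow> real k * (2 * h) < r - h"
    using assms by (intro ennreal_less_iff) simp
  moreover have "ennreal (real (Suc (2 * k)) * h) < t \<longleftrightarrow> real (Suc (2 * k)) * h < r"
    unfolding real(2) using assms by (intro ennreal_less_iff) simp
  moreover have "ennreal (r - h) \<le> ennreal (real (Suc k) * (2 * h)) \<longleftrightarrow> r - h \<le> real (Suc k) * (2 * h)"
    using assms by (intro ennreal_le_iff) simp
  moreover have "t \<le> ennreal (real (Suc (Suc (Suc (2 * k)))) * h) \<longleftrightarrow> r \<le> real (Suc (Suc (Suc (2 * k)))) * h"
    unfolding real(2) using assms by (intro ennreal_le_iff) simp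
  moreover have "real k * (2 * h) < r - h \<longleftrightarrow> real (Suc (2 * k)) * h < r"
    "r - h \<le> real (Suc k) * (2 * h) \<longleftrightarrow> r \<le> real (Suc (Suc (Suc (2 * k)))) * h"
    by (simp_all add: algebra_simps)
  ultimately show ?thesis unfolding cell_def greaterThanAtMost_iff by presburger
next
  case top then show ?thesis by (simp add: cell_def top_unique)
qed

context hunt_process
begin

section \<open>Limits along times approaching from the right\<close>

lemma tendsto_X_from_right:
  assumes \<omega>: "\<omega> \<in> space \<Omega>" and t: "t < \<infinity>" and s: "s \<longlonglongrightarrow> t" "\<And>n. t \<le> s n"
  shows "(\<lambda>n. X (s n) \<omega>) \<longlonglongrightarrow> X t \<omega>"
proof (rule continuous_within_tendsto_compose[where S="{t..}" and f="\<lambda>s. X s \<omega>"])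
  \<comment> \<open>The sequence may take the value \<open>t\<close> itself, which the punctured
    filter ignores.\<close>
  have "at t within {t..} = at_right t"
    unfolding at_within_def by (intro arg_cong[where f="\<lambda>A. inf (nhds t) (principal A)"]) auto
  then show "continuous (at t within {t..}) (\<lambda>s. X s \<omega>)"
    using right_continuous[OF \<omega> t] by (simp add: continuous_within)
qed (use s in simp_all)

text \<open>The indicator of the living states need not be continuous on the state space, so
  convergence of the positions is not enough. What counts is that the living times are those
  strictly before the lifetime.\<close>

lemma tendsto_alive:
  assumes \<omega>: "\<omega> \<in> space \<Omega>" and t: "t < \<infinity>" and s: "s \<longlonglongrightarrow> t" "\<And>n. t \<le> s n"
  shows "(\<lambda>n. indicator (- {\<Delta>}) (X (s n) \<omega>) :: ennreal) \<longlonglongrightarrow> indicator (- {\<Delta>}) (X t \<omega>)"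
proof (cases "t < lifetime X \<Delta> \<omega>")
  case True
  have "\<forall>\<^sub>F n in sequentially. s n < lifetime X \<Delta> \<omega>"
    using s(1) True by (rule order_tendstoD)
  then have "\<forall>\<^sub>F n in sequentially. indicator (- {\<Delta>}) (X (s n) \<omega>) = (1::ennreal)"
    by eventually_elim (use alive_iff[OF \<omega>] in auto)
  then show ?thesis using True alive_iff[OF \<omega>, of t] by (simp add: tendsto_eventually)
next
  case False
  then have "\<not> s n < lifetime X \<Delta> \<omega>" for n using s(2)[of n] by (simp add: not_less)
  then have "X (s n) \<omega> = \<Delta>" for n using alive_iff[OF \<omega>] by blast
  moreover have "X t \<omega> = \<Delta>" using False alive_iff[OF \<omega>] by blast
  ultimately show ?thesis by simp
qed

text \<open>The Laplace transform of the lifetime at 1/2: the spliced path lasts twice as long as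
  the step, so discounting the step by its duration discounts that path at half the rate.\<close>

definition half_laplace :: "'s \<Rightarrow> ennreal" where
  "half_laplace x = (\<integral>\<^sup>+\<omega>. neg_exp (lifetime X \<Delta> \<omega> / 2) \<partial>P x)"

lemma measurable_half_laplace [measurable]: "half_laplace \<in> borel_measurable borel"
  unfolding half_laplace_def by measurable

lemma half_laplace_le_1: "half_laplace x \<le> 1"
proof -
  have "half_laplace x \<le> (\<integral>\<^sup>+\<omega>. 1 \<partial>P x)" unfolding half_laplace_def by (intro nn_integral_mono neg_exp_le_1)
  then show ?thesis by simp
qed

end

context symmetric_hunt_process
begin

section \<open>The reversal identity on a grid\<close>

lemma nn_integral_pair_law_mult:
  assumes [measurable]: "f \<in> borel_measurable \<Omega>" "g \<in> borel_measurable \<Omega>"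
  shows "(\<integral>\<^sup>+v. f (fst v) * g (snd v) \<partial>pair_law) = (\<integral>\<^sup>+x. (\<integral>\<^sup>+\<omega>. f \<omega> \<partial>P x) * (\<integral>\<^sup>+\<omega>. g \<omega> \<partial>P x) \<partial>\<mu>)"
  by (subst nn_integral_pair_law) (simp_all add: nn_integral_cmult nn_integral_multc)

text \<open>On the \<open>k\<close>-th cell the first path dies in \<open>(k h, (k + 1) h]\<close>
  and the second is alive at \<open>(k + j) h\<close>. Reversing the second and appending the first
  gives one path that dies in \<open>((2 k + j) h, (2 k + j + 1) h]\<close>.\<close>

lemma nn_integral_cells:
  assumes [measurable]: "f \<in> borel_measurable borel" and f: "\<And>x. f x \<le> 1" and h: "0 < h"
  shows "(\<integral>\<^sup>+v. (\<Sum>k. indicator (cell h k) (lifetime X \<Delta> (fst v)) * (c k *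
      (f (X (ennreal (real (k + j) * h)) (snd v)) * indicator (- {\<Delta>}) (X (ennreal (real (k + j) * h)) (snd v)))))
      \<partial>pair_law) =
    (\<Sum>k. c k * (\<integral>\<^sup>+x. f x * death_in (ennreal (real (2 * k + j) * h)) (ennreal (real (Suc (2 * k + j)) * h)) x \<partial>\<mu>))"
proof -
  have "(\<integral>\<^sup>+v. indicator (cell h k) (lifetime X \<Delta> (fst v)) * (c k *
      (f (X (ennreal (real (k + j) * h)) (snd v)) * indicator (- {\<Delta>}) (X (ennreal (real (k + j) * h)) (snd v))))
      \<partial>pair_law) =
    c k * (\<integral>\<^sup>+x. f x * death_in (ennreal (real (2 * k + j) * h)) (ennreal (real (Suc (2 * k + j)) * h)) x \<partial>\<mu>)"
    (is "?I = c k * ?J") for k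
  proof -
    define a where "a = ennreal (real k * h)"
    define b where "b = ennreal (real (Suc k) * h)"
    define s where "s = ennreal (real (k + j) * h)"
    have [measurable]: "cell h k \<in> sets borel" by (simp add: cell_def)
    have d: "(\<integral>\<^sup>+\<omega>. indicator (cell h k) (lifetime X \<Delta> \<omega>) \<partial>P x) = death_in a b x" for x
    proof -
      have "(\<integral>\<^sup>+\<omega>. indicator (cell h k) (lifetime X \<Delta> \<omega>) \<partial>P x) =
         (\<integral>\<^sup>+\<omega>. indicator {\<omega> \<in> space \<Omega>. lifetime X \<Delta> \<omega> \<in> cell h k} \<omega> \<partial>P x)"
        by (intro nn_integral_cong) (auto split: split_indicator)
      then show ?thesis by (simp add: death_in_def cell_def a_def b_def)
    qed
    have ab: "a \<le> b" unfolding a_def b_def using h by (intro ennreal_leI) (simp add: algebra_simps)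
    have sa: "s + a = ennreal (real (2 * k + j) * h)" "s + b = ennreal (real (Suc (2 * k + j)) * h)"
      unfolding s_def a_def b_def using h by (simp_all add: algebra_simps flip: ennreal_plus)
    have "?I = c k * (\<integral>\<^sup>+v. indicator (cell h k) (lifetime X \<Delta> (fst v)) *
        (f (X s (snd v)) * indicator (- {\<Delta>}) (X s (snd v))) \<partial>pair_law)"
      unfolding s_def[symmetric] by (subst nn_integral_cmult[symmetric]) (simp_all add: mult_ac)
    also have "\<dots> = c k * (\<integral>\<^sup>+x. killed_semigroup s f x * death_in a b x \<partial>\<mu>)"
      by (subst nn_integral_pair_law_mult[where g="\<lambda>\<omega>. f (X s \<omega>) * indicator (- {\<Delta>}) (X s \<omega>)"
            and f="\<lambda>\<omega>. indicator (cell h k) (lifetime X \<Delta> \<omega>)"])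
        (simp_all add: d mult.commute flip: killed_semigroup_def)
    also have "\<dots> = c k * ?J"
      unfolding sa[symmetric]
      by (subst nn_integral_semigroup_death_in) (simp_all add: f ab s_def)
    finally show ?thesis .
  qed
  note * = this
  have [measurable]: "cell h k \<in> sets borel" for k by (simp add: cell_def)
  show ?thesis
    by (subst nn_integral_suminf) (simp_all only: *, measurable)
qed

lemma AE_pair_law_lifetime_pos: "AE v in pair_law. 0 < lifetime X \<Delta> (fst v) \<and> 0 < lifetime X \<Delta> (snd v)"
proof -
  have "AE v in P x \<Otimes>\<^sub>M P x. 0 < lifetime X \<Delta> (fst v) \<and> 0 < lifetime X \<Delta> (snd v)" if "x \<noteq> \<Delta>" for x
  proof -
    interpret p: prob_space "P x" by (rule prob_space_P)
    interpret pair_sigma_finite "P x" "P x" ..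
    show ?thesis
    proof (rule AE_pair_measure)
      show "{v \<in> space (P x \<Otimes>\<^sub>M P x). 0 < lifetime X \<Delta> (fst v) \<and> 0 < lifetime X \<Delta> (snd v)}
          \<in> sets (P x \<Otimes>\<^sub>M P x)" by measurable
    qed (use AE_lifetime_pos[OF that] in \<open>auto elim: eventually_mono\<close>)
  qed
  then show ?thesis
    unfolding pair_law_def
    by (subst AE_bind[where B="\<Omega> \<Otimes>\<^sub>M \<Omega>"])
      (use AE_ne_cemetery in \<open>auto elim!: eventually_mono simp: measurable_cong_sets[OF sets_\<mu> refl]\<close>)
qed

lemma measurable_X_lifetime [measurable]:
  "(\<lambda>v. X (lifetime X \<Delta> (fst v)) (snd v)) \<in> borel_measurable (\<Omega> \<Otimes>\<^sub>M \<Omega>)"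
  by (rule measurable_X_at[where N="\<Omega> \<Otimes>\<^sub>M \<Omega>"]) measurable

text \<open>The intervals for the offsets 1 and 2 are adjacent and make up the shifted cell of mesh
  \<open>2 * h\<close>. Both carry the weight \<open>c k\<close>, so the two sums merge into one
  expectation over the lifetime.\<close>

lemma nn_integral_cells_sum:
  assumes [measurable]: "f \<in> borel_measurable borel" and h: "0 < h"
  shows "(\<Sum>k. c k * (\<integral>\<^sup>+x. f x * death_in (ennreal (real (2 * k + 1) * h)) (ennreal (real (Suc (2 * k + 1)) * h)) x \<partial>\<mu>)) +
    (\<Sum>k. c k * (\<integral>\<^sup>+x. f x * death_in (ennreal (real (2 * k + 2) * h)) (ennreal (real (Suc (2 * k + 2)) * h)) x \<partial>\<mu>)) =
    (\<integral>\<^sup>+x. f x * (\<integral>\<^sup>+\<omega>. (\<Sum>k. indicator (cell (2 * h) k) (lifetime X \<Delta> \<omega> - ennreal h) * c k) \<partial>P x) \<partial>\<mu>)"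
    (is "?L1 + ?L2 = ?R")
proof -
  define d where "d j k = death_in (ennreal (real (2 * k + j) * h)) (ennreal (real (Suc (2 * k + j)) * h))" for j k
  have [measurable]: "d j k \<in> borel_measurable borel" for j k unfolding d_def by measurable
  have [measurable]: "cell h k \<in> sets borel" for h k by (simp add: cell_def)
  have D: "(\<integral>\<^sup>+\<omega>. indicator (cell (2 * h) k) (lifetime X \<Delta> \<omega> - ennreal h) \<partial>P x) = d 1 k x + d 2 k x" for k x
  proof -
    have le: "ennreal (real (2 * k + 1) * h) \<le> ennreal (real (2 * k + 2) * h)"
      "ennreal (real (2 * k + 2) * h) \<le> ennreal (real (2 * k + 3) * h)"
      using h by (intro ennreal_leI mult_right_mono; simp)+
    have "(\<integral>\<^sup>+\<omega>. indicator (cell (2 * h) k) (lifetime X \<Delta> \<omega> - ennreal h) \<partial>P x) =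
      (\<integral>\<^sup>+\<omega>. indicator {\<omega> \<in> space \<Omega>. lifetime X \<Delta> \<omega> \<in>
        {ennreal (real (Suc (2 * k)) * h)<..ennreal (real (Suc (Suc (Suc (2 * k)))) * h)}} \<omega> \<partial>P x)"
      by (intro nn_integral_cong) (simp only: indicator_def minus_mem_cell_iff[OF h] mem_Collect_eq simp_thms space_P)
    also have "\<dots> = death_in (ennreal (real (Suc (2 * k)) * h)) (ennreal (real (Suc (Suc (Suc (2 * k)))) * h)) x"
      unfolding death_in_def by (rule nn_integral_indicator) measurable
    also have "\<dots> = d 1 k x + d 2 k x"
      using death_in_add[OF le, of x] by (simp add: d_def numeral_3_eq_3 del: of_nat_Suc of_nat_mult of_nat_add)
    finally show ?thesis .
  qed
  have "?L1 + ?L2 = (\<Sum>k. c k * (\<integral>\<^sup>+x. f x * d 1 k x \<partial>\<mu>) + c k * (\<integral>\<^sup>+x. f x * d 2 k x \<partial>\<mu>))"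
    unfolding d_def by (rule suminf_add) auto
  also have "\<dots> = (\<Sum>k. \<integral>\<^sup>+x. f x * ((d 1 k x + d 2 k x) * c k) \<partial>\<mu>)"
    by (intro suminf_cong)
      (simp add: nn_integral_cmult[symmetric] nn_integral_add[symmetric] algebra_simps)
  also have "\<dots> = (\<integral>\<^sup>+x. (\<Sum>k. f x * ((d 1 k x + d 2 k x) * c k)) \<partial>\<mu>)"
    by (rule nn_integral_suminf[symmetric]) measurable
  also have "\<dots> = ?R"
    by (intro nn_integral_cong)
      (simp add: nn_integral_suminf nn_integral_multc D)
  finally show ?thesis .
qed

text \<open>The discount is taken at \<open>(k + 1) h\<close>, which is half the right end of the
  cell of mesh \<open>2 h\<close> containing \<open>t - h\<close>; that right end converges to
  \<open>t\<close>.\<close>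

lemma tendsto_neg_exp_cells:
  assumes t: "0 < t" and h: "h \<longlonglongrightarrow> 0" "\<And>n. 0 < h n"
  shows "(\<lambda>n. \<Sum>k. indicator (cell (2 * h n) k) (t - ennreal (h n)) * neg_exp (ennreal (real (Suc k) * h n)))
    \<longlonglongrightarrow> neg_exp (t / 2)"
proof (cases t)
  case top
  then show ?thesis by (simp add: suminf_cell_top ennreal_divide_eq_top_iff ennreal_top_divide)
next
  case (real r)
  then have r: "0 < r" using t by simp
  define k where "k n = cell_index (2 * h n) (r - h n)" for n
  have lim: "(\<lambda>n. real (Suc (k n)) * (2 * h n)) \<longlonglongrightarrow> r"
    unfolding k_def
  proof (rule tendsto_cell_index)
    show "(\<lambda>n. r - h n) \<longlonglongrightarrow> r" using tendsto_diff[OF tendsto_const h(1), of r] by simp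
    show "(\<lambda>n. 2 * h n) \<longlonglongrightarrow> 0" using tendsto_mult[OF tendsto_const h(1), of 2] by simp
  qed (use r h in auto)
  have "(\<lambda>n. ennreal (exp (- (real (Suc (k n)) * (2 * h n) / 2)))) \<longlonglongrightarrow> ennreal (exp (- (r / 2)))"
    by (intro tendsto_intros lim) simp
  moreover have "\<forall>\<^sub>F n in sequentially. h n < r" using h(1) r by (rule order_tendstoD)
  then have "\<forall>\<^sub>F n in sequentially. ennreal (exp (- (real (Suc (k n)) * (2 * h n) / 2))) =
      (\<Sum>k. indicator (cell (2 * h n) k) (t - ennreal (h n)) * neg_exp (ennreal (real (Suc k) * h n)))"
  proof eventually_elim
    case (elim n)
    have "t - ennreal (h n) \<in> cell (2 * h n) (k n)"
      using cell_index(3)[of "2 * h n" "r - h n"] h(2)[of n] elim real by (simp add: k_def ennreal_minus)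
    then show ?case
      using h(2)[of n] by (subst suminf_cell_eq) (simp_all add: neg_exp_ennreal)
  qed
  ultimately have "(\<lambda>n. \<Sum>k. indicator (cell (2 * h n) k) (t - ennreal (h n)) * neg_exp (ennreal (real (Suc k) * h n)))
    \<longlonglongrightarrow> ennreal (exp (- (r / 2)))"
    by (rule Lim_transform_eventually)
  moreover have "t / 2 = ennreal (r / 2)"
    using real divide_ennreal[of r 2] by simp
  ultimately show ?thesis using r by (simp add: neg_exp_ennreal)
qed

text \<open>Since \<open>1 \<le> j\<close>, the evaluation time \<open>(k + j) h\<close> is not
  before \<open>t\<close>, and it exceeds \<open>t\<close> by less than \<open>j\<close> mesh sizes,
  so right-continuity applies.\<close>

lemma tendsto_cells_pair:
  fixes f :: "'s \<Rightarrow> real"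
  assumes f: "continuous_on UNIV f" and \<omega>: "\<omega> \<in> space \<Omega>"
    and t: "0 < t" and h: "h \<longlonglongrightarrow> 0" "\<And>n. 0 < h n" and j: "1 \<le> j"
  shows "(\<lambda>n. \<Sum>k. indicator (cell (h n) k) t * (neg_exp (ennreal (real (Suc k) * h n)) *
      (ennreal (f (X (ennreal (real (k + j) * h n)) \<omega>)) * indicator (- {\<Delta>}) (X (ennreal (real (k + j) * h n)) \<omega>))))
    \<longlonglongrightarrow> neg_exp t * (ennreal (f (X t \<omega>)) * indicator (- {\<Delta>}) (X t \<omega>))"
proof (cases t)
  case top
  then show ?thesis by (simp add: suminf_cell_top)
next
  case (real r)
  then have r: "0 < r" using t by simp
  define k where "k n = cell_index (h n) r" for n
  define s where "s n = ennreal (real (k n + j) * h n)" for n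
  have lim: "(\<lambda>n. real (Suc (k n)) * h n) \<longlonglongrightarrow> r"
    unfolding k_def using r h by (intro tendsto_cell_index) auto
  have "(\<lambda>n. real (Suc (k n)) * h n + real (j - 1) * h n) \<longlonglongrightarrow> r + real (j - 1) * 0"
    by (intro tendsto_intros lim h)
  also have "(\<lambda>n. real (Suc (k n)) * h n + real (j - 1) * h n) = (\<lambda>n. real (k n + j) * h n)"
    using j by (auto simp: of_nat_diff algebra_simps)
  finally have s: "s \<longlonglongrightarrow> t" unfolding s_def real by (intro tendsto_ennrealI) simp
  have ge: "t \<le> s n" for n
  proof -
    have "r \<le> real (Suc (k n)) * h n" unfolding k_def by (rule cell_index(2)[OF h(2) r])
    also have "\<dots> \<le> real (k n + j) * h n" using j h(2)[of n] by (intro mult_right_mono) auto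
    finally show ?thesis unfolding s_def real by (rule ennreal_leI)
  qed
  have fin: "t < \<infinity>" using real by simp
  have e: "(\<lambda>n. neg_exp (ennreal (real (Suc (k n)) * h n))) \<longlonglongrightarrow> neg_exp t"
  proof -
    have "(\<lambda>n. ennreal (exp (- (real (Suc (k n)) * h n)))) \<longlonglongrightarrow> ennreal (exp (- r))"
      by (intro tendsto_intros lim)
    then show ?thesis using real h(2) r by (simp add: neg_exp_ennreal less_imp_le del: of_nat_Suc)
  qed
  have "(\<lambda>n. f (X (s n) \<omega>)) \<longlonglongrightarrow> f (X t \<omega>)"
    using continuous_on_tendsto_compose[OF f tendsto_X_from_right[OF \<omega> fin s ge]] by simp
  then have "(\<lambda>n. neg_exp (ennreal (real (Suc (k n)) * h n)) *
      (ennreal (f (X (s n) \<omega>)) * indicator (- {\<Delta>}) (X (s n) \<omega>)))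
    \<longlonglongrightarrow> neg_exp t * (ennreal (f (X t \<omega>)) * indicator (- {\<Delta>}) (X t \<omega>))"
    using neg_exp_le_1[of t]
    by (intro tendsto_mult_ennreal tendsto_ennrealI tendsto_alive[OF \<omega> fin s ge] e)
      (auto simp: indicator_def ennreal_mult_eq_top_iff top_unique)
  moreover have "t \<in> cell (h n) (k n)" for n
    unfolding real k_def by (rule cell_index(3)[OF h(2) r])
  note suminf_cell_eq[OF h(2) this]
  ultimately show ?thesis by (simp only: s_def)
qed

text \<open>
  The lifetime of the first path is rounded up to the grid of mesh \<open>h\<close>, and the second path is evaluated
  one (\<open>F 1\<close>) or two (\<open>F 2\<close>) grid points after the left end of the cell. By symmetry the two versions
  become sums over cells with odd and even left ends; together these cover \<open>(h, \<infinity>)\<close>, which explains the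
  factor 2 in the limit.
\<close>

lemma nn_integral_pair_law_continuous:
  fixes f :: "'s \<Rightarrow> real"
  assumes f: "continuous_on UNIV f" and f01: "\<And>x. 0 \<le> f x \<and> f x \<le> 1"
  shows "2 * (\<integral>\<^sup>+v. neg_exp (lifetime X \<Delta> (fst v)) * (ennreal (f (X (lifetime X \<Delta> (fst v)) (snd v))) *
      indicator (- {\<Delta>}) (X (lifetime X \<Delta> (fst v)) (snd v))) \<partial>pair_law) =
    (\<integral>\<^sup>+x. ennreal (f x) * half_laplace x \<partial>\<mu>)"
    (is "2 * ?I = ?J")
proof -
  have [measurable]: "f \<in> borel_measurable borel" using f by (rule borel_measurable_continuous_onI)
  have [measurable]: "cell h k \<in> sets borel" for h k by (simp add: cell_def)
  have fm: "(\<lambda>x. ennreal (f x)) \<in> borel_measurable borel" by measurable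
  have f1: "ennreal (f x) \<le> 1" for x using f01[of x] by simp
  define h where "h n = inverse (real (Suc n))" for n
  have h: "h \<longlonglongrightarrow> 0" "\<And>n. 0 < h n"
    unfolding h_def using LIMSEQ_inverse_real_of_nat by (simp_all del: of_nat_Suc)
  let ?c = "\<lambda>n k. neg_exp (ennreal (real (Suc k) * h n))"
  define F where "F j n v = (\<Sum>k. indicator (cell (h n) k) (lifetime X \<Delta> (fst v)) * (?c n k *
      (ennreal (f (X (ennreal (real (k + j) * h n)) (snd v))) *
        indicator (- {\<Delta>}) (X (ennreal (real (k + j) * h n)) (snd v)))))" for j n v
  define G where "G n \<omega> = (\<Sum>k. indicator (cell (2 * h n) k) (lifetime X \<Delta> \<omega> - ennreal (h n)) * ?c n k)" for n \<omega>
  have [measurable]: "F j n \<in> borel_measurable (\<Omega> \<Otimes>\<^sub>M \<Omega>)" for j n unfolding F_def by measurable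
  have [measurable]: "G n \<in> borel_measurable \<Omega>" for n unfolding G_def by measurable
  have F_lim: "(\<lambda>n. integral\<^sup>N pair_law (F j n)) \<longlonglongrightarrow> ?I" if j: "1 \<le> j" for j
  proof (rule nn_integral_dominated_convergence[where w="\<lambda>_. 1"])
    have "F j n v \<le> 1" for n v
      unfolding F_def using h(2) f1
      by (intro suminf_cell_le mult_le_one neg_exp_le_1) (auto split: split_indicator)
    then show "AE v in pair_law. F j n v \<le> 1" for n by simp
    show "AE v in pair_law. (\<lambda>n. F j n v) \<longlonglongrightarrow> neg_exp (lifetime X \<Delta> (fst v)) *
        (ennreal (f (X (lifetime X \<Delta> (fst v)) (snd v))) * indicator (- {\<Delta>}) (X (lifetime X \<Delta> (fst v)) (snd v)))"
      using AE_pair_law_lifetime_pos AE_space[of pair_law]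
    proof eventually_elim
      case (elim v)
      then show ?case unfolding F_def
        by (intro tendsto_cells_pair f h j) (auto simp: space_pair_measure)
    qed
    interpret finite_measure pair_law by (rule finite_pair_law)
    show "(\<integral>\<^sup>+v. 1 \<partial>pair_law) < \<infinity>" using emeasure_finite[of "space pair_law"] by (simp add: less_top[symmetric])
  qed measurable
  have G_le: "G n \<omega> \<le> 1" for n \<omega>
    unfolding G_def using h(2) by (intro suminf_cell_le neg_exp_le_1) simp
  have G_int_le: "integral\<^sup>N (P x) (G n) \<le> 1" for n x
    using nn_integral_mono[of "P x" "G n" "\<lambda>_. 1"] G_le by simp
  have G_lim: "(\<lambda>n. integral\<^sup>N (P x) (G n)) \<longlonglongrightarrow> half_laplace x" if "x \<noteq> \<Delta>" for x
    unfolding half_laplace_def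
  proof (rule nn_integral_dominated_convergence[where w="\<lambda>_. 1"])
    show "AE \<omega> in P x. (\<lambda>n. G n \<omega>) \<longlonglongrightarrow> neg_exp (lifetime X \<Delta> \<omega> / 2)"
      using AE_lifetime_pos[OF that] unfolding G_def
      by eventually_elim (rule tendsto_neg_exp_cells[OF _ h])
  qed (use G_le in simp_all)
  have "(\<lambda>n. \<integral>\<^sup>+x. ennreal (f x) * integral\<^sup>N (P x) (G n) \<partial>\<mu>) \<longlonglongrightarrow> ?J"
  proof (rule nn_integral_dominated_convergence[where w="\<lambda>_. 1"])
    show "AE x in \<mu>. (\<lambda>n. ennreal (f x) * integral\<^sup>N (P x) (G n)) \<longlonglongrightarrow> ennreal (f x) * half_laplace x"
      using AE_ne_cemetery
    proof eventually_elim
      case (elim x)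
      show ?case
        using half_laplace_le_1[of x] by (intro tendsto_mult_ennreal tendsto_const G_lim elim) (auto simp: top_unique)
    qed
    show "AE x in \<mu>. ennreal (f x) * integral\<^sup>N (P x) (G n) \<le> 1" for n
      using f1 G_int_le by (intro AE_I2 mult_le_one) auto
  qed (simp_all add: less_top[symmetric])
  \<comment> \<open>At every mesh the identity is exact; limits are taken only afterwards, on each
    side separately.\<close>
  moreover have "(\<integral>\<^sup>+x. ennreal (f x) * integral\<^sup>N (P x) (G n) \<partial>\<mu>) =
      integral\<^sup>N pair_law (F 1 n) + integral\<^sup>N pair_law (F 2 n)" for n
    unfolding F_def G_def by (simp only: nn_integral_cells[OF fm f1 h(2)] nn_integral_cells_sum[OF fm h(2)])
  ultimately have "(\<lambda>n. integral\<^sup>N pair_law (F 1 n) + integral\<^sup>N pair_law (F 2 n)) \<longlonglongrightarrow> ?J" by simp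
  moreover have "(\<lambda>n. integral\<^sup>N pair_law (F 1 n) + integral\<^sup>N pair_law (F 2 n)) \<longlonglongrightarrow> ?I + ?I"
    by (intro tendsto_add F_lim) simp_all
  ultimately show ?thesis using LIMSEQ_unique by (fastforce simp: mult_2)
qed

text \<open>Both sides integrate \<open>f\<close> against finite Borel measures: \<open>N1\<close>
  is twice the discounted law of the second path's position when it outlives the first, and
  \<open>N2\<close> has density \<open>half_laplace\<close>. Agreement on continuous functions makes
  them equal.\<close>

lemma nn_integral_pair_law_less:
  assumes f [measurable]: "f \<in> borel_measurable borel"
  shows "2 * (\<integral>\<^sup>+v. neg_exp (lifetime X \<Delta> (fst v)) * (f (X (lifetime X \<Delta> (fst v)) (snd v)) *
      indicator (- {\<Delta>}) (X (lifetime X \<Delta> (fst v)) (snd v))) \<partial>pair_law) =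
    (\<integral>\<^sup>+x. f x * half_laplace x \<partial>\<mu>)"
proof -
  let ?Y = "\<lambda>v. X (lifetime X \<Delta> (fst v)) (snd v)"
  let ?w = "\<lambda>v. 2 * (neg_exp (lifetime X \<Delta> (fst v)) * indicator (- {\<Delta>}) (?Y v)) :: ennreal"
  define N1 where "N1 = distr (density pair_law ?w) borel ?Y"
  define N2 where "N2 = density \<mu> half_laplace"
  have int1: "integral\<^sup>N N1 g = 2 * (\<integral>\<^sup>+v. neg_exp (lifetime X \<Delta> (fst v)) * (g (?Y v) * indicator (- {\<Delta>}) (?Y v)) \<partial>pair_law)"
    if [measurable]: "g \<in> borel_measurable borel" for g
    unfolding N1_def by (simp add: nn_integral_distr nn_integral_density mult_ac flip: nn_integral_cmult)
  have int2: "integral\<^sup>N N2 g = (\<integral>\<^sup>+x. g x * half_laplace x \<partial>\<mu>)" if [measurable]: "g \<in> borel_measurable borel" for g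
    unfolding N2_def by (simp add: nn_integral_density mult.commute)
  have sets: "sets N1 = sets borel" "sets N2 = sets borel" by (simp_all add: N1_def N2_def)
  have space: "space N1 = UNIV" "space N2 = UNIV" by (simp_all add: N1_def N2_def)
  have eq: "(\<integral>\<^sup>+x. ennreal (g x) \<partial>N1) = (\<integral>\<^sup>+x. ennreal (g x) \<partial>N2)"
    if g: "continuous_on UNIV g" "\<And>x. 0 \<le> g x \<and> g x \<le> 1" for g
  proof -
    have [measurable]: "g \<in> borel_measurable borel" using g(1) by (rule borel_measurable_continuous_onI)
    show ?thesis by (simp add: int1 int2 nn_integral_pair_law_continuous[OF g])
  qed
  have "emeasure N2 UNIV = (\<integral>\<^sup>+x. half_laplace x \<partial>\<mu>)" using int2[of "\<lambda>_. 1"] by (simp add: space)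
  also have "\<dots> < \<infinity>" by (intro nn_integral_le_1_finite half_laplace_le_1)
  finally have fin2: "emeasure N2 UNIV < \<infinity>" .
  \<comment> \<open>The constant function 1 is continuous, so \<open>N1\<close> inherits finite mass
    from \<open>N2\<close>.\<close>
  moreover have "emeasure N1 UNIV = emeasure N2 UNIV" using eq[of "\<lambda>_. 1"] by (simp add: space)
  ultimately have "N1 = N2"
    by (intro borel_measure_eqI_continuous sets eq finite_measureI) (simp_all add: space less_top[symmetric])
  then show ?thesis using int1[OF f] int2[OF f] by simp
qed

section \<open>Ties and the full one-step identity\<close>

lemma nn_integral_pair_law_swap:
  assumes [measurable]: "f \<in> borel_measurable (\<Omega> \<Otimes>\<^sub>M \<Omega>)"
  shows "(\<integral>\<^sup>+v. f (snd v, fst v) \<partial>pair_law) = (\<integral>\<^sup>+v. f v \<partial>pair_law)"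
proof -
  have "(\<integral>\<^sup>+\<omega>. \<integral>\<^sup>+\<omega>'. f (\<omega>', \<omega>) \<partial>P x \<partial>P x) = (\<integral>\<^sup>+\<omega>. \<integral>\<^sup>+\<omega>'. f (\<omega>, \<omega>') \<partial>P x \<partial>P x)" for x
  proof -
    interpret p: prob_space "P x" by (rule prob_space_P)
    interpret pair_sigma_finite "P x" "P x" ..
    show ?thesis by (rule Fubini') simp
  qed
  then show ?thesis by (simp add: nn_integral_pair_law)
qed

text \<open>Given the common starting point the two survival events are independent, and reversal
  with \<open>s = t\<close> merges the two factors into survival up to \<open>t + t\<close>.\<close>

lemma emeasure_pair_law_min_greater:
  assumes t: "t < \<infinity>"
  shows "emeasure pair_law {v \<in> space pair_law. t < min (lifetime X \<Delta> (fst v)) (lifetime X \<Delta> (snd v))} =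
    emeasure path_law {\<omega> \<in> space path_law. t < lifetime X \<Delta> \<omega> / 2}"
proof -
  have "emeasure pair_law {v \<in> space pair_law. t < min (lifetime X \<Delta> (fst v)) (lifetime X \<Delta> (snd v))} =
    (\<integral>\<^sup>+v. indicator {\<omega> \<in> space \<Omega>. t < lifetime X \<Delta> \<omega>} (fst v) *
      indicator {\<omega> \<in> space \<Omega>. t < lifetime X \<Delta> \<omega>} (snd v) \<partial>pair_law)"
    by (subst nn_integral_indicator[symmetric], measurable, intro nn_integral_cong)
      (auto simp: space_pair_measure split: split_indicator)
  also have "\<dots> = (\<integral>\<^sup>+x. killed_semigroup t (\<lambda>_. 1) x * survival t x \<partial>\<mu>)"
    by (subst nn_integral_pair_law_mult) (simp_all add: survival_def flip: survival_eq_semigroup)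
  also have "\<dots> = (\<integral>\<^sup>+x. survival (t + t) x \<partial>\<mu>)"
    by (subst nn_integral_semigroup_survival) (use t in simp_all)
  also have "\<dots> = (\<integral>\<^sup>+\<omega>. indicator {\<omega> \<in> space path_law. t < lifetime X \<Delta> \<omega> / 2} \<omega> \<partial>path_law)"
  proof -
    have *: "t < z / 2 \<longleftrightarrow> t + t < z" for z
    proof (cases z)
      case (real r)
      obtain s where "t = ennreal s" "0 \<le> s" using t by (cases t) auto
      then show ?thesis using real divide_ennreal[of r 2]
        by (simp add: ennreal_less_iff flip: ennreal_plus) auto
    next
      case top then show ?thesis using t by (simp add: ennreal_top_divide)
    qed
    show ?thesis unfolding survival_def *
      by (subst nn_integral_path_law) simp_all
  qed
  finally show ?thesis by simp
qed

lemma nn_integral_pair_law_min: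
  "(\<integral>\<^sup>+v. neg_exp (min (lifetime X \<Delta> (fst v)) (lifetime X \<Delta> (snd v))) \<partial>pair_law) = (\<integral>\<^sup>+x. half_laplace x \<partial>\<mu>)"
proof -
  let ?m = "\<lambda>v. min (lifetime X \<Delta> (fst v)) (lifetime X \<Delta> (snd v))" and ?h = "\<lambda>\<omega>. lifetime X \<Delta> \<omega> / 2"
  interpret pl: finite_measure path_law by (rule finite_path_law)
  interpret pr: finite_measure pair_law by (rule finite_pair_law)
  have tot: "emeasure pair_law (space pair_law) = emeasure path_law (space path_law)"
    using nn_integral_pair_law[of "\<lambda>_. 1"] nn_integral_path_law[of "\<lambda>_. 1"] by simp
  \<comment> \<open>Open half-lines never contain 0, so \<open>UNIV\<close> is added to provide an
    exhausting set of finite measure; on it the total masses are compared.\<close>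
  let ?E = "insert UNIV (range (greaterThan :: ennreal \<Rightarrow> _))"
  have gen: "sets borel = sigma_sets UNIV ?E"
    unfolding borel_Ioi by (auto intro!: sigma_sets_eqI intro: sigma_sets.Basic sigma_sets_top)
  have "distr pair_law borel ?m = distr path_law borel ?h"
  proof (rule measure_eqI_generator_eq[where E="?E" and \<Omega>=UNIV and A="\<lambda>_. UNIV"])
    have "{a<..} \<inter> {b<..} = {max a b<..}" for a b :: ennreal by auto
    then show "Int_stable ?E" unfolding Int_stable_def by fastforce
    show "sets (distr pair_law borel ?m) = sigma_sets UNIV ?E"
      "sets (distr path_law borel ?h) = sigma_sets UNIV ?E"
      unfolding sets_distr by (rule gen)+
    show "emeasure (distr pair_law borel ?m) UNIV \<noteq> \<infinity>" by (simp add: emeasure_distr)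
    fix A assume "A \<in> ?E"
    then consider "A = UNIV" | t where "A = {t<..}" "t < \<infinity>" | "A = {\<infinity><..}" by (auto simp: less_top[symmetric])
    then show "emeasure (distr pair_law borel ?m) A = emeasure (distr path_law borel ?h) A"
    proof cases
      case 1
      then show ?thesis using tot by (simp add: emeasure_distr)
    next
      case (2 t)
      then show ?thesis using emeasure_pair_law_min_greater[of t]
        by (simp add: emeasure_distr vimage_def Int_def conj_commute del: min_less_iff_conj)
    next
      case 3
      then have "A = {}" by auto
      then show ?thesis by simp
    qed
  qed auto
  then have "integral\<^sup>N (distr pair_law borel ?m) neg_exp = integral\<^sup>N (distr path_law borel ?h) neg_exp"
    by simp
  then show ?thesis
    by (simp add: nn_integral_distr nn_integral_path_law half_laplace_def)
qed

text \<open>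
  Since \<open>(P\<^sub>t 1, P\<^sub>t 1) = (1, P\<^sub>2\<^sub>t 1)\<close>, the minimum of the two lifetimes is distributed like \<open>\<zeta> / 2\<close>. So the
  two events \<open>\<zeta> < \<zeta>'\<close> and \<open>\<zeta>' < \<zeta>\<close> already exhaust the discounted mass, and nothing is left for ties.
\<close>

lemma AE_pair_law_no_tie:
  "AE v in pair_law. lifetime X \<Delta> (fst v) = lifetime X \<Delta> (snd v) \<longrightarrow> lifetime X \<Delta> (fst v) = \<infinity>"
proof -
  let ?a = "\<lambda>v. lifetime X \<Delta> (fst v)" and ?b = "\<lambda>v. lifetime X \<Delta> (snd v)"
  let ?L = "\<lambda>v. neg_exp (?a v) * of_bool (?a v < ?b v)"
  let ?R = "\<lambda>v. neg_exp (?b v) * of_bool (?b v < ?a v)"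
  let ?T = "\<lambda>v. neg_exp (?a v) * of_bool (?a v = ?b v)"
  have "(\<integral>\<^sup>+v. ?L v \<partial>pair_law) = (\<integral>\<^sup>+v. neg_exp (?a v) * (1 * indicator (- {\<Delta>}) (X (?a v) (snd v))) \<partial>pair_law)"
    by (intro nn_integral_cong) (auto simp: space_pair_measure simp flip: alive_iff split: split_indicator)
  then have L: "2 * (\<integral>\<^sup>+v. ?L v \<partial>pair_law) = (\<integral>\<^sup>+x. half_laplace x \<partial>\<mu>)"
    using nn_integral_pair_law_less[of "\<lambda>_. 1"] by simp
  have R: "(\<integral>\<^sup>+v. ?R v \<partial>pair_law) = (\<integral>\<^sup>+v. ?L v \<partial>pair_law)"
    using nn_integral_pair_law_swap[of ?L] by simp
  have "(\<integral>\<^sup>+x. half_laplace x \<partial>\<mu>) = (\<integral>\<^sup>+v. (?L v + ?R v) + ?T v \<partial>pair_law)"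
    unfolding nn_integral_pair_law_min[symmetric]
    by (intro nn_integral_cong) (auto simp: min_def)
  also have "\<dots> = (\<integral>\<^sup>+x. half_laplace x \<partial>\<mu>) + (\<integral>\<^sup>+v. ?T v \<partial>pair_law)"
    unfolding L[symmetric] by (simp add: nn_integral_add R mult_2)
  finally have "(\<integral>\<^sup>+x. half_laplace x \<partial>\<mu>) + 0 = (\<integral>\<^sup>+x. half_laplace x \<partial>\<mu>) + (\<integral>\<^sup>+v. ?T v \<partial>pair_law)" by simp
  \<comment> \<open>Finiteness permits the cancellation that leaves no discounted mass for ties.
    Ties at infinity have discount 0 and are not detected.\<close>
  moreover have "(\<integral>\<^sup>+x. half_laplace x \<partial>\<mu>) < \<infinity>" by (intro nn_integral_le_1_finite half_laplace_le_1)
  ultimately have "(\<integral>\<^sup>+v. ?T v \<partial>pair_law) = 0"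
    by (subst (asm) ennreal_add_left_cancel) auto
  then have "AE v in pair_law. ?T v = 0" by (subst (asm) nn_integral_0_iff_AE) simp_all
  then show ?thesis by eventually_elim (auto simp: neg_exp_eq_0_iff)
qed

text \<open>The two orders of death contribute equally by exchangeability, which absorbs the factor
  2. Ties, where \<open>f\<close> would be taken at the cemetery, are null at finite times and
  discounted to 0 at infinity.\<close>

lemma nn_integral_fv_survivor:
  assumes [measurable]: "f \<in> borel_measurable borel"
  shows "(\<integral>\<^sup>+v. neg_exp (fv_duration X \<Delta> v) * f (fv_survivor X \<Delta> v) \<partial>pair_law) = (\<integral>\<^sup>+x. f x * half_laplace x \<partial>\<mu>)"
proof -
  let ?a = "\<lambda>v. lifetime X \<Delta> (fst v)" and ?b = "\<lambda>v. lifetime X \<Delta> (snd v)"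
  define L where "L v = neg_exp (?a v) * (f (X (?a v) (snd v)) * indicator (- {\<Delta>}) (X (?a v) (snd v)))" for v
  have [measurable]: "L \<in> borel_measurable (\<Omega> \<Otimes>\<^sub>M \<Omega>)" unfolding L_def by measurable
  have L0: "L v = (if ?a v < ?b v then neg_exp (?a v) * f (X (?a v) (snd v)) else 0)"
    if "snd v \<in> space \<Omega>" for v
    using alive_iff[OF that, of "?a v"] by (auto simp: L_def split: split_indicator)
  have "(\<integral>\<^sup>+v. neg_exp (fv_duration X \<Delta> v) * f (fv_survivor X \<Delta> v) \<partial>pair_law) =
      (\<integral>\<^sup>+v. L v + L (snd v, fst v) \<partial>pair_law)"
  proof (rule nn_integral_cong_AE, use AE_pair_law_no_tie AE_space[of pair_law] in eventually_elim)
    case (elim v)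
    then have "fst v \<in> space \<Omega>" "snd v \<in> space \<Omega>" by (auto simp: space_pair_measure)
    then show ?case using elim(1)
      by (cases v) (auto simp: L0 fv_duration_def fv_survivor_def min_def not_less not_le)
  qed
  also have "\<dots> = 2 * (\<integral>\<^sup>+v. L v \<partial>pair_law)"
    by (simp add: nn_integral_add nn_integral_pair_law_swap mult_2)
  also have "\<dots> = (\<integral>\<^sup>+x. f x * half_laplace x \<partial>\<mu>)"
    unfolding L_def by (rule nn_integral_pair_law_less) simp
  finally show ?thesis .
qed

section \<open>Null events for a single path\<close>

text \<open>Two copies from a common starting point both die at \<open>t\<close> with the square of
  the single probability. Such ties are null, so the square vanishes for almost every starting
  point.\<close>

lemma AE_path_law_lifetime_ne:
  assumes "0 < t" "t < \<infinity>"
  shows "AE \<omega> in path_law. lifetime X \<Delta> \<omega> \<noteq> t"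
proof -
  let ?i = "\<lambda>\<omega>. of_bool (lifetime X \<Delta> \<omega> = t) :: ennreal"
  have "(\<integral>\<^sup>+x. (\<integral>\<^sup>+\<omega>. ?i \<omega> \<partial>P x) * (\<integral>\<^sup>+\<omega>. ?i \<omega> \<partial>P x) \<partial>\<mu>) = (\<integral>\<^sup>+v. ?i (fst v) * ?i (snd v) \<partial>pair_law)"
    by (rule nn_integral_pair_law_mult[symmetric]) measurable
  also have "\<dots> = (\<integral>\<^sup>+v. 0 \<partial>pair_law)"
    using AE_pair_law_no_tie by (intro nn_integral_cong_AE) (use assms in \<open>auto elim!: eventually_mono\<close>)
  finally have "(\<integral>\<^sup>+x. (\<integral>\<^sup>+\<omega>. ?i \<omega> \<partial>P x) * (\<integral>\<^sup>+\<omega>. ?i \<omega> \<partial>P x) \<partial>\<mu>) = 0" by simp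
  then have "AE x in \<mu>. (\<integral>\<^sup>+\<omega>. ?i \<omega> \<partial>P x) = 0"
    by (subst (asm) nn_integral_0_iff_AE) (auto elim!: eventually_mono)
  then have "(\<integral>\<^sup>+x. (\<integral>\<^sup>+\<omega>. ?i \<omega> \<partial>P x) \<partial>\<mu>) = 0"
    by (subst nn_integral_0_iff_AE) simp_all
  then have "(\<integral>\<^sup>+\<omega>. ?i \<omega> \<partial>path_law) = 0"
    by (subst nn_integral_path_law) simp_all
  then have "AE \<omega> in path_law. ?i \<omega> = 0"
    by (subst (asm) nn_integral_0_iff_AE) simp_all
  then show ?thesis by eventually_elim auto
qed

lemma AE_path_law_lifetime_pos: "AE \<omega> in path_law. 0 < lifetime X \<Delta> \<omega>"
  unfolding path_law_def
  by (subst AE_bind[where B=\<Omega>])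
    (use AE_ne_cemetery AE_lifetime_pos in \<open>auto elim!: eventually_mono simp: measurable_cong_sets[OF sets_\<mu> refl] measurable_P\<close>)

text \<open>By symmetry the law of the living position at time \<open>t\<close> has density
  \<open>killed_semigroup t (\<lambda>_. 1)\<close> with respect to \<open>\<mu>\<close>, so null
  sets are not charged.\<close>

lemma AE_path_law_null:
  fixes f :: "'s \<Rightarrow> ennreal"
  assumes [measurable]: "f \<in> borel_measurable borel" and f1: "\<And>x. f x \<le> 1"
    and f0: "AE x in \<mu>. f x = 0" and t: "t < \<infinity>"
  shows "AE \<omega> in path_law. t < lifetime X \<Delta> \<omega> \<longrightarrow> f (X t \<omega>) = 0"
proof -
  have "(\<integral>\<^sup>+\<omega>. f (X t \<omega>) * indicator (- {\<Delta>}) (X t \<omega>) \<partial>path_law) = (\<integral>\<^sup>+x. killed_semigroup t f x * 1 \<partial>\<mu>)"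
    by (subst nn_integral_path_law) (simp_all add: killed_semigroup_def)
  also have "\<dots> = (\<integral>\<^sup>+x. f x * killed_semigroup t (\<lambda>_. 1) x \<partial>\<mu>)"
    by (rule semigroup_symmetric) (use f1 t in simp_all)
  also have "\<dots> = (\<integral>\<^sup>+x. 0 \<partial>\<mu>)"
    using f0 by (intro nn_integral_cong_AE) (auto elim!: eventually_mono)
  finally have "(\<integral>\<^sup>+\<omega>. f (X t \<omega>) * indicator (- {\<Delta>}) (X t \<omega>) \<partial>path_law) = 0" by simp
  then have "AE \<omega> in path_law. f (X t \<omega>) * indicator (- {\<Delta>}) (X t \<omega>) = 0"
    by (subst (asm) nn_integral_0_iff_AE) simp_all
  then show ?thesis using AE_space[of path_law]
    by eventually_elim (auto simp: alive_iff split: split_indicator_asm)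
qed

end

section \<open>One step of the two-particle system\<close>

context hunt_process
begin

declare measurable_fv_survivor [measurable]

lemma measurable_fv_duration [measurable]: "fv_duration X \<Delta> \<in> borel_measurable (\<Omega> \<Otimes>\<^sub>M \<Omega>)"
  unfolding fv_duration_def split_beta by measurable

text \<open>The discounted one-step operator of the system. Only the first step can start from two
  different points; all later ones are governed by \<open>diag_op\<close>.\<close>

definition fv_op :: "('s \<Rightarrow> ennreal) \<Rightarrow> 's \<Rightarrow> 's \<Rightarrow> ennreal" where
  "fv_op f x y = (\<integral>\<^sup>+v. neg_exp (fv_duration X \<Delta> v) * f (fv_survivor X \<Delta> v) \<partial>(P x \<Otimes>\<^sub>M P y))"

definition diag_op :: "('s \<Rightarrow> ennreal) \<Rightarrow> 's \<Rightarrow> ennreal" where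
  "diag_op f x = fv_op f x x"

lemma measurable_fv_op:
  assumes [measurable]: "f \<in> borel_measurable borel"
  shows "(\<lambda>(x, y). fv_op f x y) \<in> borel_measurable (borel \<Otimes>\<^sub>M borel)"
proof -
  have "(\<lambda>z. P (fst z) \<Otimes>\<^sub>M P (snd z)) \<in> borel \<Otimes>\<^sub>M borel \<rightarrow>\<^sub>M subprob_algebra (\<Omega> \<Otimes>\<^sub>M \<Omega>)"
    by (rule measurable_pair_measure) measurable
  then show ?thesis
    unfolding fv_op_def split_beta
    by (rule measurable_compose[OF _ nn_integral_measurable_subprob_algebra]) measurable
qed

lemma measurable_diag_op [measurable]:
  assumes [measurable]: "f \<in> borel_measurable borel"
  shows "diag_op f \<in> borel_measurable borel"
  using measurable_compose[OF _ measurable_fv_op[OF assms], of "\<lambda>x. (x, x)" borel]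
  unfolding diag_op_def by simp

lemma measurable_diag_op_funpow [measurable]:
  "f \<in> borel_measurable borel \<Longrightarrow> (diag_op ^^ n) f \<in> borel_measurable borel"
  by (induction n) auto

lemma fv_op_mono: "(\<And>x. f x \<le> g x) \<Longrightarrow> fv_op f x y \<le> fv_op g x y"
  unfolding fv_op_def by (intro nn_integral_mono mult_left_mono) auto

lemma fv_op_le_1:
  assumes "\<And>x. f x \<le> 1" shows "fv_op f x y \<le> 1"
proof -
  interpret prob_space "P x \<Otimes>\<^sub>M P y" by (intro prob_space_pair prob_space_P)
  have "fv_op f x y \<le> (\<integral>\<^sup>+v. 1 \<partial>(P x \<Otimes>\<^sub>M P y))"
    unfolding fv_op_def by (intro nn_integral_mono mult_le_one neg_exp_le_1 assms) simp
  then show ?thesis using emeasure_space_1 by simp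
qed

text \<open>Monotone convergence for decreasing sequences, valid because everything is bounded by 1
  under a probability measure. It turns the limit of the iterates into a fixed point.\<close>

lemma fv_op_INF:
  fixes f :: "nat \<Rightarrow> 's \<Rightarrow> ennreal"
  assumes [measurable]: "\<And>n. f n \<in> borel_measurable borel"
    and dec: "\<And>n x. f (Suc n) x \<le> f n x" and f1: "\<And>n x. f n x \<le> 1"
  shows "fv_op (\<lambda>x. INF n. f n x) x y = (INF n. fv_op (f n) x y)"
proof -
  have sets [measurable_cong]: "sets (P x \<Otimes>\<^sub>M P y) = sets (\<Omega> \<Otimes>\<^sub>M \<Omega>)" by (rule sets_pair_measure_cong) simp_all
  have eq: "neg_exp t * (INF n. f n z) = (INF n. neg_exp t * f n z)" for t z
  proof (rule LIMSEQ_unique)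
    have "neg_exp t < \<top>" using neg_exp_le_1[of t] by (rule le_less_trans) simp
    then show "(\<lambda>n. neg_exp t * f n z) \<longlonglongrightarrow> neg_exp t * (INF n. f n z)"
      using dec by (intro ennreal_tendsto_cmult LIMSEQ_INF decseq_SucI)
    show "(\<lambda>n. neg_exp t * f n z) \<longlonglongrightarrow> (INF n. neg_exp t * f n z)"
      using dec by (intro LIMSEQ_INF decseq_SucI mult_left_mono) simp_all
  qed
  show ?thesis
    unfolding fv_op_def eq
  proof (rule nn_integral_monotone_convergence_INF_AE[where i=0])
    show "AE v in P x \<Otimes>\<^sub>M P y. neg_exp (fv_duration X \<Delta> v) * f (Suc n) (fv_survivor X \<Delta> v)
        \<le> neg_exp (fv_duration X \<Delta> v) * f n (fv_survivor X \<Delta> v)" for n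
      by (intro AE_I2 mult_left_mono dec) simp
    show "(\<integral>\<^sup>+v. neg_exp (fv_duration X \<Delta> v) * f 0 (fv_survivor X \<Delta> v) \<partial>(P x \<Otimes>\<^sub>M P y)) < \<infinity>"
      using fv_op_le_1[of "f 0" x y, OF f1] by (simp add: fv_op_def) (metis ennreal_one_less_top le_less_trans)
  qed measurable
qed

text \<open>The \<open>n\<close>-th iterate is the expected discount at the \<open>n\<close>-th
  branching time when both particles start at \<open>x\<close>. At the cemetery no time passes and
  the value is 1, so simultaneous deaths count as extinction.\<close>

definition discount_limit :: "'s \<Rightarrow> ennreal" where
  "discount_limit x = (INF n. (diag_op ^^ n) (\<lambda>_. 1) x)"

lemma measurable_discount_limit [measurable]: "discount_limit \<in> borel_measurable borel"
  unfolding discount_limit_def by measurable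

lemma diag_op_funpow_le_1: "(diag_op ^^ n) (\<lambda>_. 1) x \<le> 1"
  by (induction n arbitrary: x) (auto simp: diag_op_def intro: fv_op_le_1)

lemma diag_op_funpow_dec: "(diag_op ^^ Suc n) (\<lambda>_. 1) x \<le> (diag_op ^^ n) (\<lambda>_. 1) x"
proof (induction n arbitrary: x)
  case 0 show ?case using diag_op_funpow_le_1[of 1 x] by simp
next
  case (Suc n)
  then show ?case unfolding funpow.simps(2)[of "Suc n"] funpow.simps(2)[of n "diag_op"] comp_def
    by (subst (1 2) diag_op_def) (auto intro: fv_op_mono)
qed

lemma fv_op_discount_limit:
  "fv_op discount_limit x y = (INF n. fv_op ((diag_op ^^ n) (\<lambda>_. 1)) x y)"
  using fv_op_INF[where f="\<lambda>n. (diag_op ^^ n) (\<lambda>_. 1)", OF _ diag_op_funpow_dec diag_op_funpow_le_1] by (simp add: discount_limit_def[abs_def])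

lemma diag_op_discount_limit: "diag_op discount_limit x = discount_limit x"
proof -
  have "diag_op discount_limit x = (INF n. (diag_op ^^ Suc n) (\<lambda>_. 1) x)"
    by (simp add: diag_op_def fv_op_discount_limit)
  also have "\<dots> = discount_limit x"
    unfolding discount_limit_def
  proof (rule antisym)
    show "(INF n. (diag_op ^^ Suc n) (\<lambda>_. 1) x) \<le> (INF n. (diag_op ^^ n) (\<lambda>_. 1) x)"
      by (rule INF_mono) (use diag_op_funpow_dec in blast)
    show "(INF n. (diag_op ^^ n) (\<lambda>_. 1) x) \<le> (INF n. (diag_op ^^ Suc n) (\<lambda>_. 1) x)"
      by (intro INF_greatest INF_lower UNIV_I)
  qed
  finally show ?thesis .
qed

lemma discount_limit_le_1: "discount_limit x \<le> 1"
  unfolding discount_limit_def by (rule INF_lower2[of 0]) simp_all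

end

context symmetric_hunt_process
begin

section \<open>The limiting discount vanishes almost everywhere\<close>

lemma nn_integral_diag_op:
  assumes [measurable]: "f \<in> borel_measurable borel"
  shows "(\<integral>\<^sup>+x. diag_op f x \<partial>\<mu>) = (\<integral>\<^sup>+x. f x * half_laplace x \<partial>\<mu>)"
  unfolding nn_integral_fv_survivor[OF assms, symmetric] diag_op_def fv_op_def pair_law_def
  by (rule nn_integral_bind[symmetric, where B="\<Omega> \<Otimes>\<^sub>M \<Omega>"])
    (simp_all add: measurable_diagonal measurable_cong_sets[OF sets_\<mu> refl])

lemma half_laplace_less_1: 
  assumes "x \<noteq> \<Delta>" shows "half_laplace x < 1"
proof -
  interpret prob_space "P x" by (rule prob_space_P)
  have pos: "AE \<omega> in P x. neg_exp (lifetime X \<Delta> \<omega> / 2) < 1"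
    using AE_lifetime_pos[OF assms]
    by eventually_elim (auto intro!: neg_exp_less_1 simp: ennreal_zero_less_divide)
  have "\<not> (AE \<omega> in P x. 1 \<le> neg_exp (lifetime X \<Delta> \<omega> / 2))"
  proof
    assume "AE \<omega> in P x. 1 \<le> neg_exp (lifetime X \<Delta> \<omega> / 2)"
    with pos have "AE \<omega> in P x. False" by eventually_elim simp
    then show False using AE_False by simp
  qed
  then have "(\<integral>\<^sup>+\<omega>. neg_exp (lifetime X \<Delta> \<omega> / 2) \<partial>P x) < (\<integral>\<^sup>+\<omega>. 1 \<partial>P x)"
    using half_laplace_le_1[of x]
    by (intro nn_integral_less) (auto simp: half_laplace_def top_unique neg_exp_le_1)
  then show ?thesis by (simp add: half_laplace_def)
qed

lemma AE_discount_limit: "AE x in \<mu>. discount_limit x = 0"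
proof -
  have fin: "(\<integral>\<^sup>+x. discount_limit x \<partial>\<mu>) < \<infinity>"
    by (intro nn_integral_le_1_finite discount_limit_le_1)
  have "(\<integral>\<^sup>+x. discount_limit x * (1 - half_laplace x) \<partial>\<mu>) =
      (\<integral>\<^sup>+x. discount_limit x - discount_limit x * half_laplace x \<partial>\<mu>)"
  proof (intro nn_integral_cong)
    fix x
    have "discount_limit x \<noteq> \<top>" using discount_limit_le_1[of x] by (auto simp: top_unique)
    then show "discount_limit x * (1 - half_laplace x) = discount_limit x - discount_limit x * half_laplace x"
      by (simp add: ennreal_right_diff_distrib)
  qed
  also have "\<dots> = (\<integral>\<^sup>+x. discount_limit x \<partial>\<mu>) - (\<integral>\<^sup>+x. discount_limit x * half_laplace x \<partial>\<mu>)"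
  proof (rule nn_integral_diff)
    show "AE x in \<mu>. discount_limit x * half_laplace x \<le> discount_limit x"
      using mult_left_mono[OF half_laplace_le_1] by (intro AE_I2) fastforce
    then have "(\<integral>\<^sup>+x. discount_limit x * half_laplace x \<partial>\<mu>) \<le> (\<integral>\<^sup>+x. discount_limit x \<partial>\<mu>)"
      by (rule nn_integral_mono_AE)
    then show "(\<integral>\<^sup>+x. discount_limit x * half_laplace x \<partial>\<mu>) \<noteq> \<infinity>" using fin by (auto simp: top_unique)
  qed measurable
  \<comment> \<open>The fixed-point property and the one-step identity make the two integrals equal,
    and they are finite because \<open>\<mu>\<close> is.\<close>
  also have "\<dots> = 0"
    using nn_integral_diag_op[of discount_limit] fin by (simp add: diag_op_discount_limit)
  finally have "AE x in \<mu>. discount_limit x * (1 - half_laplace x) = 0"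
    by (subst (asm) nn_integral_0_iff_AE) simp_all
  then show ?thesis using AE_ne_cemetery
  proof eventually_elim
    case (elim x)
    then show ?case using half_laplace_less_1[of x] by (auto dest: ennreal_minus_eq_0)
  qed
qed

text \<open>With independent starting points the whole paths are independent, so the lifetime of one
  is a fixed time for the other. At a fixed time the position has a law absolutely continuous with
  respect to \<open>\<mu>\<close>, where \<open>f\<close> vanishes.\<close>

lemma AE_fv_op_off_diagonal:
  assumes [measurable]: "f \<in> borel_measurable borel" and f1: "\<And>x. f x \<le> 1"
    and f0: "AE x in \<mu>. f x = 0"
  shows "AE z in \<mu> \<Otimes>\<^sub>M \<mu>. fv_op f (fst z) (snd z) = 0"
proof -
  interpret pl: finite_measure path_law by (rule finite_path_law)
  interpret pp: pair_sigma_finite path_law path_law ..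
  let ?a = "\<lambda>v. lifetime X \<Delta> (fst v)" and ?b = "\<lambda>v. lifetime X \<Delta> (snd v)"
  let ?L = "path_law \<Otimes>\<^sub>M path_law"
  define H where "H v = neg_exp (fv_duration X \<Delta> v) * f (fv_survivor X \<Delta> v)" for v
  have [measurable]: "H \<in> borel_measurable (\<Omega> \<Otimes>\<^sub>M \<Omega>)" unfolding H_def by measurable
  have less: "AE v in ?L. ?a v < ?b v \<longrightarrow> f (X (?a v) (snd v)) = 0"
  proof (rule pp.AE_pair_measure)
    show "{v \<in> space ?L. ?a v < ?b v \<longrightarrow> f (X (?a v) (snd v)) = 0} \<in> sets ?L" by measurable
    show "AE \<omega> in path_law. AE \<omega>' in path_law. ?a (\<omega>, \<omega>') < ?b (\<omega>, \<omega>') \<longrightarrow> f (X (?a (\<omega>, \<omega>')) (snd (\<omega>, \<omega>'))) = 0"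
    proof (rule AE_I2)
      fix \<omega>
      show "AE \<omega>' in path_law. ?a (\<omega>, \<omega>') < ?b (\<omega>, \<omega>') \<longrightarrow> f (X (?a (\<omega>, \<omega>')) (snd (\<omega>, \<omega>'))) = 0"
        using AE_path_law_null[OF assms(1) f1 f0, of "lifetime X \<Delta> \<omega>"]
        by (cases "lifetime X \<Delta> \<omega> < \<infinity>") (auto simp: less_top[symmetric])
    qed
  qed
  have "AE v in distr ?L ?L (\<lambda>(x, y). (y, x)). ?a v < ?b v \<longrightarrow> f (X (?a v) (snd v)) = 0"
    using less by (subst pp.distr_pair_swap[symmetric])
  then have "AE v in ?L. case v of (x, y) \<Rightarrow> ?a (y, x) < ?b (y, x) \<longrightarrow> f (X (?a (y, x)) (snd (y, x))) = 0"
    by (rule AE_distrD[rotated, where f="\<lambda>(x, y). (y, x)", THEN eventually_mono]) (auto simp: measurable_pair_swap')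
  \<comment> \<open>Finite ties have to be excluded, since \<open>f\<close> may be positive at the
    cemetery. For a fixed first path they require the second to die at one prescribed time.\<close>
  moreover have "AE v in ?L. ?a v = ?b v \<longrightarrow> ?a v = \<infinity>"
  proof (rule pp.AE_pair_measure)
    show "{v \<in> space ?L. ?a v = ?b v \<longrightarrow> ?a v = \<infinity>} \<in> sets ?L" by measurable
    show "AE \<omega> in path_law. AE \<omega>' in path_law. ?a (\<omega>, \<omega>') = ?b (\<omega>, \<omega>') \<longrightarrow> ?a (\<omega>, \<omega>') = \<infinity>"
      using AE_path_law_lifetime_pos
    proof eventually_elim
      case (elim \<omega>)
      then show ?case
      proof (cases "lifetime X \<Delta> \<omega> < \<infinity>")
        case True
        show ?thesis using AE_path_law_lifetime_ne[OF elim True] by eventually_elim auto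
      qed (auto simp: less_top[symmetric])
    qed
  qed
  ultimately have "AE v in ?L. H v = 0"
    using less
  proof eventually_elim
    case (elim v)
    then show ?case
      by (cases v) (auto simp: H_def fv_duration_def fv_survivor_def min_def not_less not_le)
  qed
  then have H0: "(\<integral>\<^sup>+\<omega>. (\<integral>\<^sup>+\<omega>'. H (\<omega>, \<omega>') \<partial>path_law) \<partial>path_law) = 0"
    by (subst pl.nn_integral_fst) (simp_all add: nn_integral_0_iff_AE measurable_cong_sets[OF sets_pair_measure_cong[OF sets_path_law sets_path_law] refl])
  have "(\<integral>\<^sup>+z. fv_op f (fst z) (snd z) \<partial>(\<mu> \<Otimes>\<^sub>M \<mu>)) = (\<integral>\<^sup>+x. (\<integral>\<^sup>+y. fv_op f x y \<partial>\<mu>) \<partial>\<mu>)"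
    using measurable_fv_op[OF assms(1)]
    by (subst \<mu>.nn_integral_fst[symmetric])
      (simp_all add: split_beta measurable_cong_sets[OF sets_pair_measure_cong[OF sets_\<mu> sets_\<mu>] refl])
  also have "\<dots> = (\<integral>\<^sup>+x. (\<integral>\<^sup>+\<omega>. (\<integral>\<^sup>+\<omega>'. H (\<omega>, \<omega>') \<partial>path_law) \<partial>P x) \<partial>\<mu>)"
  proof (rule nn_integral_cong)
    fix x
    interpret p: prob_space "P x" by (rule prob_space_P)
    interpret pair_sigma_finite \<mu> "P x" ..
    have 1: "fv_op f x y = (\<integral>\<^sup>+\<omega>. (\<integral>\<^sup>+\<omega>'. H (\<omega>, \<omega>') \<partial>P y) \<partial>P x)" for y
    proof -
      interpret q: prob_space "P y" by (rule prob_space_P)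
      show ?thesis unfolding fv_op_def H_def[symmetric]
        by (rule q.nn_integral_fst[symmetric]) simp
    qed
    \<comment> \<open>Exchanging the second starting point with the first path lets
      \<open>P y\<close> and \<open>\<mu>\<close> combine into \<open>path_law\<close>.\<close>
    have "(\<integral>\<^sup>+y. fv_op f x y \<partial>\<mu>) = (\<integral>\<^sup>+\<omega>. (\<integral>\<^sup>+y. (\<integral>\<^sup>+\<omega>'. H (\<omega>, \<omega>') \<partial>P y) \<partial>\<mu>) \<partial>P x)"
      unfolding 1
    proof (rule Fubini'[symmetric])
      show "(\<lambda>(y, \<omega>). \<integral>\<^sup>+\<omega>'. H (\<omega>, \<omega>') \<partial>P y) \<in> borel_measurable (\<mu> \<Otimes>\<^sub>M P x)"
        unfolding split_beta
        by (rule nn_integral_measurable_subprob_algebra2[where N=\<Omega>]) measurable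
    qed
    also have "\<dots> = (\<integral>\<^sup>+\<omega>. (\<integral>\<^sup>+\<omega>'. H (\<omega>, \<omega>') \<partial>path_law) \<partial>P x)"
      by (intro nn_integral_cong nn_integral_path_law[symmetric]) simp
    finally show "(\<integral>\<^sup>+y. fv_op f x y \<partial>\<mu>) = (\<integral>\<^sup>+\<omega>. (\<integral>\<^sup>+\<omega>'. H (\<omega>, \<omega>') \<partial>path_law) \<partial>P x)" .
  qed
  also have "\<dots> = 0"
    unfolding H0[symmetric] by (rule nn_integral_path_law[symmetric]) measurable
  finally show ?thesis
    using measurable_fv_op[OF assms(1)]
    by (subst (asm) nn_integral_0_iff_AE)
      (simp_all add: split_beta measurable_cong_sets[OF sets_pair_measure_cong[OF sets_\<mu> sets_\<mu>] refl])
qed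

end

section \<open>The branching times\<close>

lemma branching_time_cong: "(\<And>i. i < n \<Longrightarrow> w i = w' i) \<Longrightarrow> branching_time X \<Delta> n w = branching_time X \<Delta> n w'"
  by (induction n) auto

lemma incseq_branching_time: "incseq (\<lambda>n. branching_time X \<Delta> n w)"
  by (rule incseq_SucI) simp

lemma limit_branching_time_eq_SUP: "limit_branching_time X \<Delta> w = (SUP n. branching_time X \<Delta> n w)"
  unfolding limit_branching_time_def by (intro limI LIMSEQ_SUP incseq_branching_time)

context hunt_process
begin

text \<open>The index set is kept general because both finite products and the full sequence space
  occur.\<close>

lemma measurable_branching_time:
  "{0..<n} \<subseteq> J \<Longrightarrow> branching_time X \<Delta> n \<in> borel_measurable (PiM J (\<lambda>_. \<Omega> \<Otimes>\<^sub>M \<Omega>))"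
proof (induction n)
  case (Suc n)
  have "(\<lambda>w. w n) \<in> PiM J (\<lambda>_. \<Omega> \<Otimes>\<^sub>M \<Omega>) \<rightarrow>\<^sub>M \<Omega> \<Otimes>\<^sub>M \<Omega>"
    using Suc.prems by (intro measurable_component_singleton) auto
  note [measurable] = measurable_compose[OF this measurable_fv_duration]
  have [measurable]: "branching_time X \<Delta> n \<in> borel_measurable (PiM J (\<lambda>_. \<Omega> \<Otimes>\<^sub>M \<Omega>))"
    using Suc.prems by (intro Suc.IH) auto
  show ?case unfolding branching_time.simps(2)[abs_def] by measurable
qed (simp add: branching_time.simps(1)[abs_def])

text \<open>Given the earlier steps, the last one starts with both particles at the previous
  survivor. Integrating it out replaces \<open>f\<close> by \<open>diag_op f\<close> and lowers
  \<open>n\<close>, hence the induction over arbitrary \<open>f\<close>.\<close>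

lemma nn_integral_fv_law:
  assumes "f \<in> borel_measurable borel"
  shows "(\<integral>\<^sup>+w. neg_exp (branching_time X \<Delta> (Suc n) w) * f (fv_survivor X \<Delta> (w n)) \<partial>fv_law \<Omega> P X \<Delta> x y) =
    fv_op ((diag_op ^^ n) f) x y"
  using assms
proof (induction n arbitrary: f)
  case (0 f)
  note [measurable] = 0
  interpret IT: Ionescu_Tulcea "fv_kernel P X \<Delta> x y" "\<lambda>_. \<Omega> \<Otimes>\<^sub>M \<Omega>" by (rule Ionescu_Tulcea_fv_kernel)
  let ?G = "\<lambda>w. neg_exp (branching_time X \<Delta> 1 w) * f (fv_survivor X \<Delta> (w 0))"
  have [measurable]: "(\<lambda>w. w 0) \<in> PiM {0..<Suc 0} (\<lambda>_. \<Omega> \<Otimes>\<^sub>M \<Omega>) \<rightarrow>\<^sub>M \<Omega> \<Otimes>\<^sub>M \<Omega>"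
    by (rule measurable_component_singleton) simp
  have G: "?G \<in> borel_measurable (PiM {0..<Suc 0} (\<lambda>_. \<Omega> \<Otimes>\<^sub>M \<Omega>))"
    by simp
  have "(\<integral>\<^sup>+w. ?G w \<partial>fv_law \<Omega> P X \<Delta> x y) = (\<integral>\<^sup>+w. fv_op f x y \<partial>IT.PF.lim)"
    using IT.nn_integral_lim_Suc[OF G] unfolding fv_law_def by (simp add: fv_op_def)
  also have "\<dots> = fv_op f x y"
    using prob_space.emeasure_space_1[OF IT.prob_space_lim] by simp
  finally show ?case by simp
next
  case (Suc n f)
  note [measurable] = Suc.prems
  interpret IT: Ionescu_Tulcea "fv_kernel P X \<Delta> x y" "\<lambda>_. \<Omega> \<Otimes>\<^sub>M \<Omega>" by (rule Ionescu_Tulcea_fv_kernel)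
  have cmult: "(\<integral>\<^sup>+v. neg_exp a * (neg_exp (fv_duration X \<Delta> v) * f (fv_survivor X \<Delta> v)) \<partial>(P z \<Otimes>\<^sub>M P z)) =
      neg_exp a * diag_op f z" for a z
    unfolding diag_op_def fv_op_def by (rule nn_integral_cmult) measurable
  let ?G = "\<lambda>w. neg_exp (branching_time X \<Delta> (Suc (Suc n)) w) * f (fv_survivor X \<Delta> (w (Suc n)))"
  have [measurable]: "(\<lambda>w. w (Suc n)) \<in> PiM {0..<Suc (Suc n)} (\<lambda>_. \<Omega> \<Otimes>\<^sub>M \<Omega>) \<rightarrow>\<^sub>M \<Omega> \<Otimes>\<^sub>M \<Omega>"
    by (rule measurable_component_singleton) simp
  have [measurable]: "branching_time X \<Delta> (Suc (Suc n)) \<in> borel_measurable (PiM {0..<Suc (Suc n)} (\<lambda>_. \<Omega> \<Otimes>\<^sub>M \<Omega>))"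
    by (rule measurable_branching_time) simp
  have G: "?G \<in> borel_measurable (PiM {0..<Suc (Suc n)} (\<lambda>_. \<Omega> \<Otimes>\<^sub>M \<Omega>))"
    by measurable
  have restr: "?G (restrict w {0..<Suc (Suc n)}) = ?G w" for w
    by (subst branching_time_cong[of "Suc (Suc n)" _ w]) auto
  have step: "(\<integral>\<^sup>+v. ?G ((restrict w {0..<Suc n})(Suc n := v)) \<partial>fv_kernel P X \<Delta> x y (Suc n) (restrict w {0..<Suc n})) =
    neg_exp (branching_time X \<Delta> (Suc n) w) * diag_op f (fv_survivor X \<Delta> (w n))" for w
  proof -
    have "branching_time X \<Delta> (Suc n) ((restrict w {0..<Suc n})(Suc n := v)) = branching_time X \<Delta> (Suc n) w" for v
      by (rule branching_time_cong) auto
    then have "?G ((restrict w {0..<Suc n})(Suc n := v)) =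
        neg_exp (branching_time X \<Delta> (Suc n) w) * (neg_exp (fv_duration X \<Delta> v) * f (fv_survivor X \<Delta> v))" for v
      by (subst branching_time.simps(2)) (simp add: neg_exp_add mult_ac del: branching_time.simps)
    then show ?thesis by (simp add: cmult del: branching_time.simps fun_upd_restrict)
  qed
  have "(\<integral>\<^sup>+w. ?G w \<partial>fv_law \<Omega> P X \<Delta> x y) =
    (\<integral>\<^sup>+w. neg_exp (branching_time X \<Delta> (Suc n) w) * diag_op f (fv_survivor X \<Delta> (w n)) \<partial>fv_law \<Omega> P X \<Delta> x y)"
    using IT.nn_integral_lim_Suc[OF G] unfolding fv_law_def restr step .
  also have "\<dots> = fv_op ((diag_op ^^ n) (diag_op f)) x y"
    by (rule Suc.IH) measurable
  finally show ?case by (simp only: funpow_Suc_right comp_def)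
qed

text \<open>The limit is at least every branching time, so its expected discount is at most every
  \<open>fv_op ((diag_op ^^ n) (\<lambda>_. 1)) x y\<close>, and the infimum of these is 0.\<close>

lemma prob_limit_branching_time:
  assumes "fv_op discount_limit x y = 0"
  shows "\<P>(w in fv_law \<Omega> P X \<Delta> x y. limit_branching_time X \<Delta> w = \<infinity>) = 1"
proof -
  interpret IT: Ionescu_Tulcea "fv_kernel P X \<Delta> x y" "\<lambda>_. \<Omega> \<Otimes>\<^sub>M \<Omega>" by (rule Ionescu_Tulcea_fv_kernel)
  let ?L = "fv_law \<Omega> P X \<Delta> x y"
  interpret L: prob_space ?L unfolding fv_law_def by (rule IT.prob_space_lim)
  have sets [measurable_cong]: "sets ?L = sets (PiM UNIV (\<lambda>_. \<Omega> \<Otimes>\<^sub>M \<Omega>))"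
    unfolding fv_law_def by (rule IT.PF.sets_lim)
  have [measurable]: "branching_time X \<Delta> n \<in> borel_measurable (PiM UNIV (\<lambda>_. \<Omega> \<Otimes>\<^sub>M \<Omega>))" for n
    by (rule measurable_branching_time) simp
  have [measurable]: "limit_branching_time X \<Delta> \<in> borel_measurable (PiM UNIV (\<lambda>_. \<Omega> \<Otimes>\<^sub>M \<Omega>))"
    unfolding limit_branching_time_eq_SUP[abs_def] by measurable
  have "(\<integral>\<^sup>+w. neg_exp (limit_branching_time X \<Delta> w) \<partial>?L) \<le> fv_op ((diag_op ^^ n) (\<lambda>_. 1)) x y" for n
  proof -
    have "(\<integral>\<^sup>+w. neg_exp (limit_branching_time X \<Delta> w) \<partial>?L) \<le> (\<integral>\<^sup>+w. neg_exp (branching_time X \<Delta> (Suc n) w) \<partial>?L)"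
      unfolding limit_branching_time_eq_SUP
      by (intro nn_integral_mono neg_exp_antimono SUP_upper UNIV_I)
    then show ?thesis using nn_integral_fv_law[where f="\<lambda>_. 1" and n=n and x=x and y=y] by simp
  qed
  then have "(\<integral>\<^sup>+w. neg_exp (limit_branching_time X \<Delta> w) \<partial>?L) \<le> fv_op discount_limit x y"
    unfolding fv_op_discount_limit by (rule INF_greatest)
  then have "(\<integral>\<^sup>+w. neg_exp (limit_branching_time X \<Delta> w) \<partial>?L) = 0" using assms by simp
  then have "AE w in ?L. neg_exp (limit_branching_time X \<Delta> w) = 0"
    by (subst (asm) nn_integral_0_iff_AE) simp_all
  then have "AE w in ?L. limit_branching_time X \<Delta> w = \<infinity>" by (simp add: neg_exp_eq_0_iff)
  then show ?thesis by (subst L.prob_Collect_eq_1) simp_all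
qed

end

section \<open>From the given reference measure to the extended state space\<close>

text \<open>The identity acts as the inclusion of a subspace, so a measure on the living states can
  be pushed forward to the extended space.\<close>

lemma measurable_ident_subspace:
  "sets m = sets (restrict_space borel A) \<Longrightarrow> (\<lambda>x. x) \<in> m \<rightarrow>\<^sub>M borel"
  unfolding measurable_cong_sets[of m "restrict_space borel A" borel borel, OF _ refl]
  by (rule measurable_restrict_space1) simp

text \<open>The bound by 1 keeps all values finite, so the passage between real and extended values
  loses nothing.\<close>

lemma (in hunt_process) transition_op_eq_semigroup:
  assumes [measurable]: "f \<in> borel_measurable borel" and f: "\<And>x. f x \<le> 1"
  shows "transition_op P X \<Delta> t (\<lambda>x. enn2real (f x)) x = enn2real (killed_semigroup t f x)"
proof -
  have "transition_op P X \<Delta> t (\<lambda>x. enn2real (f x)) x =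
      (LINT \<omega>|P x. enn2real (f (X t \<omega>) * indicator (- {\<Delta>}) (X t \<omega>)))"
    unfolding transition_op_def set_lebesgue_integral_def
    by (intro Bochner_Integration.integral_cong) (auto split: split_indicator)
  also have "\<dots> = enn2real (\<integral>\<^sup>+\<omega>. ennreal (enn2real (f (X t \<omega>) * indicator (- {\<Delta>}) (X t \<omega>))) \<partial>P x)"
    by (rule integral_eq_nn_integral) simp_all
  also have "(\<integral>\<^sup>+\<omega>. ennreal (enn2real (f (X t \<omega>) * indicator (- {\<Delta>}) (X t \<omega>))) \<partial>P x) = killed_semigroup t f x"
    unfolding killed_semigroup_def
  proof (intro nn_integral_cong ennreal_enn2real)
    show "f (X t \<omega>) * indicator (- {\<Delta>}) (X t \<omega>) < \<top>" for \<omega>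
      using le_less_trans[OF f[of "X t \<omega>"], of \<top>] by (auto split: split_indicator)
  qed
  finally show ?thesis .
qed

lemma symmetric_hunt_process_of_self_dual:
  fixes \<Omega> :: "'w measure"
    and P :: "'s::{metric_space, second_countable_topology} \<Rightarrow> 'w measure"
    and m :: "'s measure"
  assumes "hunt_process \<Omega> P X \<Delta>" and sets: "sets m = sets (restrict_space borel (- {\<Delta>}))"
    and "finite_measure m" and dual: "self_dual P X \<Delta> m"
  shows "symmetric_hunt_process \<Omega> P X \<Delta> (distr m borel (\<lambda>x. x))"
proof -
  interpret hunt_process \<Omega> P X \<Delta> by fact
  interpret m: finite_measure m by fact
  have id [measurable]: "(\<lambda>x. x) \<in> m \<rightarrow>\<^sub>M borel" using sets by (rule measurable_ident_subspace)
  have sp: "space m = - {\<Delta>}" using sets_eq_imp_space_eq[OF sets] by (simp add: space_restrict_space)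
  have meas [measurable (raw)]: "f \<in> borel_measurable borel \<Longrightarrow> f \<in> borel_measurable m" for f :: "'s \<Rightarrow> ennreal"
    using measurable_compose[OF id] by simp
  have real_le: "enn2real a \<le> 1" if "a \<le> 1" for a
    using enn2real_mono[OF that] by simp
  \<comment> \<open>Bounded functions are square integrable because \<open>m\<close> is finite; this
    is what lets self-duality be tested on them.\<close>
  have L2: "(\<lambda>x. enn2real (f x)) \<in> L2 m" if [measurable]: "f \<in> borel_measurable borel" and "\<And>x. f x \<le> 1" for f
    unfolding L2_def using real_le[OF that(2)]
    by (auto intro!: m.integrable_const_bound[where B=1] simp: power_le_one)
  have int: "(\<integral>\<^sup>+x. f x * g x \<partial>distr m borel (\<lambda>x. x)) = ennreal (LINT x|m. enn2real (f x) * enn2real (g x))"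
    if [measurable]: "f \<in> borel_measurable borel" "g \<in> borel_measurable borel" and f: "\<And>x. f x \<le> 1" and g: "\<And>x. g x \<le> 1" for f g
  proof -
    have "(\<integral>\<^sup>+x. f x * g x \<partial>distr m borel (\<lambda>x. x)) = (\<integral>\<^sup>+x. f x * g x \<partial>m)"
      by (rule nn_integral_distr) simp_all
    also have "\<dots> = (\<integral>\<^sup>+x. ennreal (enn2real (f x) * enn2real (g x)) \<partial>m)"
    proof (rule nn_integral_cong)
      fix x
      have "f x < \<top>" "g x < \<top>" using le_less_trans[OF f] le_less_trans[OF g] by simp_all
      then show "f x * g x = ennreal (enn2real (f x) * enn2real (g x))"
        by (simp add: ennreal_mult ennreal_enn2real)
    qed
    also have "\<dots> = ennreal (LINT x|m. enn2real (f x) * enn2real (g x))"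
      using real_le[OF f] real_le[OF g]
      by (intro nn_integral_eq_integral m.integrable_const_bound[where B=1]) (auto intro!: AE_I2 mult_le_one)
    finally show ?thesis .
  qed
  show ?thesis
  proof (intro symmetric_hunt_process.intro symmetric_hunt_process_axioms.intro assms(1))
    show "sets (distr m borel (\<lambda>x. x)) = sets borel" by simp
    show "finite_measure (distr m borel (\<lambda>x. x))" using id by (rule m.finite_measure_distr)
    show "AE x in distr m borel (\<lambda>x. x). x \<noteq> \<Delta>"
      by (subst AE_distr_iff) (auto simp: sp intro!: AE_I2)
    fix t :: ennreal and f g :: "'s \<Rightarrow> ennreal"
    assume t: "t < \<infinity>" and [measurable]: "f \<in> borel_measurable borel" "g \<in> borel_measurable borel"
      and f: "\<And>x. f x \<le> 1" and g: "\<And>x. g x \<le> 1"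
    have "(LINT x|m. enn2real (killed_semigroup t f x) * enn2real (g x)) =
        (LINT x|m. enn2real (f x) * enn2real (killed_semigroup t g x))"
      using dual[unfolded self_dual_def, rule_format, OF t, THEN conjunct2, rule_format,
          of "\<lambda>x. enn2real (f x)" "\<lambda>x. enn2real (g x)"]
      by (simp add: L2 f g transition_op_eq_semigroup)
    then show "(\<integral>\<^sup>+x. killed_semigroup t f x * g x \<partial>distr m borel (\<lambda>x. x)) =
        (\<integral>\<^sup>+x. f x * killed_semigroup t g x \<partial>distr m borel (\<lambda>x. x))"
      by (simp add: int f g semigroup_le_1)
  qed
qed

theorem theorem1p1:
  fixes \<Omega> :: "'w measure"
    and P :: "'s::{metric_space, second_countable_topology} \<Rightarrow> 'w measure"
    and X :: "ennreal \<Rightarrow> 'w \<Rightarrow> 's"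
    and \<Delta> :: 's
    and m :: "'s measure"
  assumes "hunt_process \<Omega> P X \<Delta>"
    and "sets m = sets (restrict_space borel (- {\<Delta>}))"
    and "finite_measure m"
    and "self_dual P X \<Delta> m"
  shows "(AE (x, y) in m \<Otimes>\<^sub>M m.
            \<P>(w in fv_law \<Omega> P X \<Delta> x y. limit_branching_time X \<Delta> w = \<infinity>) = 1) \<and>
         (AE x in m.
            \<P>(w in fv_law \<Omega> P X \<Delta> x x. limit_branching_time X \<Delta> w = \<infinity>) = 1)"
proof
  let ?\<mu> = "distr m borel (\<lambda>x. x)"
  interpret symmetric_hunt_process \<Omega> P X \<Delta> ?\<mu>
    using assms by (rule symmetric_hunt_process_of_self_dual)
  have id [measurable]: "(\<lambda>x. x) \<in> m \<rightarrow>\<^sub>M borel" using assms(2) by (rule measurable_ident_subspace)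
  have "AE x in m. discount_limit x = 0"
    using id AE_discount_limit by (rule AE_distrD)
  \<comment> \<open>On the diagonal \<open>fv_op discount_limit x x\<close> equals
    \<open>discount_limit x\<close>, by the fixed-point property.\<close>
  then show "AE x in m. \<P>(w in fv_law \<Omega> P X \<Delta> x x. limit_branching_time X \<Delta> w = \<infinity>) = 1"
    by eventually_elim (rule prob_limit_branching_time, simp add: diag_op_discount_limit[unfolded diag_op_def])
  have pair: "(\<lambda>(x, y). (x, y)) \<in> m \<Otimes>\<^sub>M m \<rightarrow>\<^sub>M borel \<Otimes>\<^sub>M borel"
    unfolding split_beta
    by (intro measurable_Pair measurable_compose[OF measurable_fst id] measurable_compose[OF measurable_snd id])
  \<comment> \<open>The product of the pushforwards is the pushforward of
    \<open>m \<Otimes>\<^sub>M m\<close>, so the null set can be pulled back.\<close>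
  have "?\<mu> \<Otimes>\<^sub>M ?\<mu> = distr (m \<Otimes>\<^sub>M m) (borel \<Otimes>\<^sub>M borel) (\<lambda>(x, y). (x, y))"
    using id id \<mu>.sigma_finite_measure by (rule pair_measure_distr)
  then have "AE z in distr (m \<Otimes>\<^sub>M m) (borel \<Otimes>\<^sub>M borel) (\<lambda>(x, y). (x, y)). fv_op discount_limit (fst z) (snd z) = 0"
    using AE_fv_op_off_diagonal[OF measurable_discount_limit discount_limit_le_1 AE_discount_limit] by (simp only:)
  then have "AE z in m \<Otimes>\<^sub>M m. fv_op discount_limit (fst z) (snd z) = 0"
    by (rule AE_distrD[OF pair, THEN eventually_mono]) auto
  then show "AE (x, y) in m \<Otimes>\<^sub>M m. \<P>(w in fv_law \<Omega> P X \<Delta> x y. limit_branching_time X \<Delta> w = \<infinity>) = 1"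
    by eventually_elim (use prob_limit_branching_time in auto)
qed

end
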